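(* Let $p\in(0,1)$ and let $(G^{(n),p})_{n\ge1}$ be the sequence of random recursive cographs of parameter $p$. Then there is a random graphon $\boldsymbol{W}$, defined on the same probability space as the process $(G^{(n),p})_{n\ge1}$, such that almost surely $G^{(n),p}$ converges to $\boldsymbol{W}$ in the sense of graphons as $n\to\infty$. (This limit is called the recursive cographon of parameter $p$.)
   Context: Random recursive cographs: $G^{(1),p}$ is the graph with one vertex. Given $G^{(n),p}$ with $n$ vertices, $G^{(n+1),p}$ is obtained as follows, with randomness independent of the past: (1) let $v$ be a uniform random vertex of $G^{(n),p}$; (2) add a new vertex $v'$ with the same set of neighbours as $v$; (3) with probability $1-p$, connect $v$ and $v'$ by an edge (with probability $p$, they are left unconnected). A graphon is a measurable symmetric function $[0,1]^2\to[0,1]$, considered up to weak isomorphism (cut distance zero); convergence of graphs to a graphon is convergence in cut distance of the associated step graphons, equivalently convergence of all (induced) subgraph densities. *)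

theory Defs
  imports "HOL-Probability.Probability" "Graph_Theory.Pair_Digraph"
begin

definition add_twin :: "'v \<Rightarrow> 'v \<Rightarrow> bool \<Rightarrow> 'v pair_pre_digraph \<Rightarrow> 'v pair_pre_digraph" where
  "add_twin v v' linked H =
     \<lparr> pverts = insert v' (pverts H),
       parcs = parcs H
         \<union> {(v', u) | u. (v, u) \<in> parcs H}
         \<union> {(u, v') | u. (u, v) \<in> parcs H}
         \<union> (if linked then {(v, v'), (v', v)} else {}) \<rparr>"

(* V n is the vertex duplicated at the step from G n to G (n + 1), and B n tells whether it is
   linked to its twin. The vertex set of G n is {..<n} and the new vertex is n. Mutual
   independence of the pairs (V n, B n) says that each step is independent of all
   earlier ones. *)
definition recursive_cographs ::
    "'a measure \<Rightarrow> real \<Rightarrow> (nat \<Rightarrow> 'a \<Rightarrow> nat pair_pre_digraph) \<Rightarrow> bool" where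
  "recursive_cographs M p G \<longleftrightarrow>
     (\<exists>V B.
        prob_space.indep_vars M (\<lambda>_. count_space UNIV) (\<lambda>n \<omega>. (V n \<omega>, B n \<omega>)) {1..}
      \<and> (\<forall>n\<ge>1. distr M (count_space UNIV) (\<lambda>\<omega>. (V n \<omega>, B n \<omega>))
                = measure_pmf (pair_pmf (pmf_of_set {..<n}) (bernoulli_pmf (1 - p))))
      \<and> (\<forall>\<omega>\<in>space M. G 1 \<omega> = \<lparr> pverts = {0}, parcs = {} \<rparr>)
      \<and> (\<forall>n\<ge>1. \<forall>\<omega>\<in>space M. G (n + 1) \<omega> = add_twin (V n \<omega>) n (B n \<omega>) (G n \<omega>)))"

(* Only the values on the unit square matter. Weak isomorphism is not divided out: two graphons
   represent the same point of the space of graphons iff their cut distance is 0. *)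
definition graphons :: "(real \<times> real \<Rightarrow> real) set" where
  "graphons = {W. W \<in> borel_measurable (restrict_space borel ({0..1} \<times> {0..1}))
     \<and> (\<forall>x\<in>{0..1}. \<forall>y\<in>{0..1}. W (x, y) \<in> {0..1} \<and> W (x, y) = W (y, x))}"

definition cut_norm :: "(real \<times> real \<Rightarrow> real) \<Rightarrow> real" where
  "cut_norm f = (SUP (S, T) \<in> {S \<in> sets borel. S \<subseteq> {0..1}} \<times> {T \<in> sets borel. T \<subseteq> {0..1}}.
     \<bar>LINT z : S \<times> T | lborel. f z\<bar>)"

abbreviation unit_interval :: "real measure" where
  "unit_interval \<equiv> restrict_space lborel {0..1}"

definition measure_preserving_bijections :: "(real \<Rightarrow> real) set" where
  "measure_preserving_bijections =
     {\<phi> \<in> unit_interval \<rightarrow>\<^sub>M unit_interval.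
        bij_betw \<phi> {0..1} {0..1}
      \<and> the_inv_into {0..1} \<phi> \<in> unit_interval \<rightarrow>\<^sub>M unit_interval
      \<and> distr unit_interval unit_interval \<phi> = unit_interval}"

definition cut_distance :: "(real \<times> real \<Rightarrow> real) \<Rightarrow> (real \<times> real \<Rightarrow> real) \<Rightarrow> real" where
  "cut_distance U W =
     (INF \<phi> \<in> measure_preserving_bijections. cut_norm (\<lambda>(x, y). U (x, y) - W (\<phi> x, \<phi> y)))"

(* The open sets of the cut (pseudo)metric are unions of weak isomorphism classes, so a measurable
   map into this space is the same as a random element, for the Borel sigma-algebra, of the
   quotient by weak isomorphism, together with a choice of representatives. *)
definition graphon_borel :: "(real \<times> real \<Rightarrow> real) measure" where
  "graphon_borel = sigma graphons
     {X. X \<subseteq> graphons \<and> (\<forall>U\<in>X. \<exists>\<epsilon>>0. \<forall>W\<in>graphons. cut_distance U W < \<epsilon> \<longrightarrow> W \<in> X)}"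

(* For a graph with vertex set {..<n}: vertex i occupies the interval [i/n, (i+1)/n), and the null
   set where a coordinate is 1 gets the value 0. *)
definition step_graphon :: "nat pair_pre_digraph \<Rightarrow> real \<times> real \<Rightarrow> real" where
  "step_graphon H = (\<lambda>(x, y).
     let n = real (card (pverts H))
     in of_bool ((nat \<lfloor>n * x\<rfloor>, nat \<lfloor>n * y\<rfloor>) \<in> parcs H))"

definition converges_to_graphon ::
    "(nat \<Rightarrow> nat pair_pre_digraph) \<Rightarrow> (real \<times> real \<Rightarrow> real) \<Rightarrow> bool" where
  "converges_to_graphon H W \<longleftrightarrow> (\<lambda>n. cut_distance (step_graphon (H n)) W) \<longlonglongrightarrow> 0"

end

theory Submission
  imports Defs
begin

text \<open>
  Draw the vertices on a line, placing every new vertex immediately to the right of the vertex that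
  it duplicates. Let \<open>rank\<close> be the position of a vertex in this order. Later insertions never change
  the relative order of the vertices present, and whether two vertices are adjacent is decided by
  the first vertex whose insertion came between them: one of them is or descends from that vertex,
  the other one is or descends from its parent, so they inherit the label (linked or not) of that
  insertion. Hence the graph with \<open>n\<close> vertices is determined by the points rank/\<open>n\<close> and the
  labels: points \<open>x < y\<close> of these are joined iff the first point in
  \<open>(x, y]\<close>, in the order of insertion, has a positive label. The same rule applied to any sequence
  of labelled points of the unit interval is a graphon, called \<open>cographon\<close> below. Up to permuting the
  \<open>n\<close> blocks of the unit interval, which the cut distance does not see, the step graphon of the graph
  is the \<open>cographon\<close> of the normalised ranks (lemmas \<open>grown_graph\<close> and
  \<open>cut_distance_step_graphon_le\<close>).

  It remains to let the points converge. The rank of a fixed vertex is the number of white balls in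
  a Polya urn: it grows by one when the uniformly chosen parent lies strictly to its left. So
  the normalised rank is a bounded martingale whose increments at time \<open>n\<close> are of order \<open>1/n\<close>. Its
  squared increments have expectations adding up to at most \<open>1/n\<close> from time \<open>n\<close> on
  (\<open>position_second_moment\<close>), which gives almost sure convergence along the cubes, and between
  consecutive cubes the sequence hardly moves. Moreover, the squared distances between the
  \<open>n\<close> normalised ranks and their limits have a sum of expectation at most 1, whereas the normalised
  ranks are exactly the multiples of \<open>1/n\<close>. A gap in the set of limit points would force a number of
  vertices proportional to \<open>n\<close> to move by a fixed amount, so the limit points are almost surely dense
  (\<open>AE_limit_position_dense\<close>).

  If the points converge to dense limits, then for almost every pair \<open>(x, y)\<close> the first point
  between \<open>x\<close> and \<open>y\<close> is eventually the same, so the cographons converge almost everywhere, hence in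
  \<open>L\<^sup>1\<close> by dominated convergence, hence in the cut norm (\<open>tendsto_cographon_L1\<close>). Since the graphs
  are discrete random variables, the limit is measurable for the Borel sets of the cut distance
  (\<open>measurable_graphon_limit\<close>).
\<close>

section \<open>The cut distance is a pseudometric\<close>

abbreviation unit_square :: "(real \<times> real) measure" where
  "unit_square \<equiv> unit_interval \<Otimes>\<^sub>M unit_interval"

lemma prob_space_unit_interval: "prob_space unit_interval"
  by (rule prob_space_restrict_space) simp_all

lemma unit_square_coordinates [measurable]:
  "fst \<in> unit_square \<rightarrow>\<^sub>M borel" "snd \<in> unit_square \<rightarrow>\<^sub>M borel"
  by (rule measurable_compose[OF measurable_fst] measurable_compose[OF measurable_snd],
      rule measurable_restrict_space1, simp)+

text \<open>
  Identifying the product of the two unit intervals with the restriction of planar Lebesgue measure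
  makes both Fubini's theorem and the original definition of the cut norm applicable.
\<close>
lemma unit_square_eq: "unit_square = restrict_space lborel ({0..1} \<times> {0..1})"
proof (rule pair_measure_eqI)
  show sf: "sigma_finite_measure unit_interval"
    by (intro prob_space_imp_sigma_finite prob_space_unit_interval)
  show "sets unit_square = sets (restrict_space lborel ({0..1} \<times> {0..1}))"
  proof (intro equalityI)
    show "sets unit_square \<subseteq> sets (restrict_space lborel ({0..1} \<times> {0..1}))"
      unfolding sets_pair_measure
    proof (rule sets.sigma_sets_subset', safe)
      fix a b assume "a \<in> sets unit_interval" "b \<in> sets unit_interval"
      then show "a \<times> b \<in> sets (restrict_space lborel ({0..1} \<times> {0..1}))"
        by (auto simp: sets_restrict_space_iff borel_Times)
    qed (auto simp: sets_restrict_space_iff borel_Times space_restrict_space)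
    have "(\<lambda>z. z) \<in> unit_square \<rightarrow>\<^sub>M restrict_space lborel ({0..1} \<times> {0..1})"
    proof (rule measurable_restrict_space2)
      show "(\<lambda>z. z) \<in> space unit_square \<rightarrow> {0..1} \<times> {0..1}"
        by (auto simp: space_pair_measure)
      have "(\<lambda>z. (fst z, snd z)) \<in> unit_square \<rightarrow>\<^sub>M borel"
        by (intro borel_measurable_Pair unit_square_coordinates)
      then show "(\<lambda>z. z) \<in> unit_square \<rightarrow>\<^sub>M lborel" by simp
    qed
    then show "sets (restrict_space lborel ({0..1} \<times> {0..1})) \<subseteq> sets unit_square"
    proof (intro subsetI)
      fix A assume id: "(\<lambda>z. z) \<in> unit_square \<rightarrow>\<^sub>M restrict_space lborel ({0..1::real} \<times> {0..1::real})"
        and A: "A \<in> sets (restrict_space lborel ({0..1::real} \<times> {0..1::real}))"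
      have "A \<subseteq> {0..1} \<times> {0..1}" using sets.sets_into_space[OF A] by (simp add: space_restrict_space)
      then have "(\<lambda>z. z) -` A \<inter> space unit_square = A"
        by (auto simp: space_pair_measure)
      then show "A \<in> sets unit_square" using measurable_sets[OF id A] by simp
    qed
  qed
  fix A B assume AB: "A \<in> sets unit_interval" "B \<in> sets unit_interval"
  then have "A \<subseteq> {0..1}" "B \<subseteq> {0..1}" "A \<in> sets lborel" "B \<in> sets lborel"
    by (auto simp: sets_restrict_space_iff)
  then show "emeasure unit_interval A * emeasure unit_interval B =
      emeasure (restrict_space lborel ({0..1} \<times> {0..1})) (A \<times> B)"
    by (simp add: emeasure_restrict_space borel_Times Sigma_mono lborel_prod[symmetric]
        lborel.emeasure_pair_measure_Times)
qed (intro prob_space_imp_sigma_finite prob_space_unit_interval)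

lemma prob_space_unit_square: "prob_space unit_square"
proof -
  interpret pair_prob_space unit_interval unit_interval
    by (simp add: pair_prob_space_def pair_sigma_finite_def prob_space_unit_interval
        prob_space_imp_sigma_finite)
  show ?thesis by (rule P.prob_space_axioms)
qed

lemma space_unit_square [simp]: "space unit_square = {0..1} \<times> {0..1}"
  by (simp add: space_pair_measure)

lemma AE_unit_square_avoids_countable:
  assumes C: "countable C"
  shows "AE z in unit_square. fst z \<notin> C \<and> snd z \<notin> C"
proof -
  interpret pair_sigma_finite unit_interval unit_interval
    by (simp add: pair_sigma_finite_def prob_space_unit_interval prob_space_imp_sigma_finite)
  have null: "C \<in> null_sets lborel" using C by (rule countable_imp_null_set_lborel)
  then have [measurable]: "C \<in> sets borel" by auto
  have ae: "AE x in unit_interval. x \<notin> C"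
    using AE_not_in[OF null] by (subst AE_restrict_space_iff) auto
  show ?thesis
  proof (rule AE_pair_measure)
    show "{z \<in> space unit_square. fst z \<notin> C \<and> snd z \<notin> C} \<in> sets unit_square" by measurable
    show "AE x in unit_interval. AE y in unit_interval. fst (x, y) \<notin> C \<and> snd (x, y) \<notin> C"
      using ae
    proof eventually_elim
      case (elim x)
      show ?case by (rule AE_mp[OF ae AE_I2]) (use elim in auto)
    qed
  qed
qed

text \<open>
  Differences of graphons and of step graphons live here. Boundedness on the square is what makes the
  supremum in the cut norm finite, so that it can be compared with other quantities.
\<close>
definition kernels :: "(real \<times> real \<Rightarrow> real) set" where
  "kernels = {f \<in> borel_measurable unit_square. \<exists>C. \<forall>z \<in> {0..1} \<times> {0..1}. \<bar>f z\<bar> \<le> C}"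

lemma graphons_measurable:
  "W \<in> graphons \<Longrightarrow> W \<in> borel_measurable unit_square"
  unfolding graphons_def unit_square_eq
  by (auto cong: measurable_cong_sets simp: sets_restrict_space_cong[OF sets_lborel])

lemma graphonsI:
  assumes "W \<in> borel_measurable unit_square"
    and "\<And>x y. x \<in> {0..1} \<Longrightarrow> y \<in> {0..1} \<Longrightarrow> W (x, y) \<in> {0..1}"
    and "\<And>x y. x \<in> {0..1} \<Longrightarrow> y \<in> {0..1} \<Longrightarrow> W (x, y) = W (y, x)"
  shows "W \<in> graphons"
proof -
  have "sets (restrict_space borel ({0..1::real} \<times> {0..1::real})) = sets unit_square"
    unfolding unit_square_eq by (rule sets_restrict_space_cong) simp
  then have "W \<in> borel_measurable (restrict_space borel ({0..1} \<times> {0..1}))"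
    using assms(1) measurable_cong_sets[OF _ refl] by blast
  then show ?thesis using assms(2,3) by (auto simp: graphons_def)
qed

lemma graphons_subset_kernels: "graphons \<subseteq> kernels"
proof
  fix W assume "W \<in> graphons"
  then have "\<forall>z \<in> {0..1} \<times> {0..1}. \<bar>W z\<bar> \<le> 1" by (auto simp: graphons_def)
  with graphons_measurable[OF \<open>W \<in> graphons\<close>] show "W \<in> kernels" unfolding kernels_def by blast
qed

lemma kernels_add: "f \<in> kernels \<Longrightarrow> g \<in> kernels \<Longrightarrow> (\<lambda>z. f z + g z) \<in> kernels"
proof -
  assume a: "f \<in> kernels" "g \<in> kernels"
  then obtain C D where "\<forall>z \<in> {0..1} \<times> {0..1}. \<bar>f z\<bar> \<le> C" "\<forall>z \<in> {0..1} \<times> {0..1}. \<bar>g z\<bar> \<le> D"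
    by (auto simp: kernels_def)
  then have "\<forall>z \<in> {0..1} \<times> {0..1}. \<bar>f z + g z\<bar> \<le> C + D" by (meson abs_triangle_ineq4 abs_triangle_ineq add_mono order_trans)
  moreover have "(\<lambda>z. f z + g z) \<in> borel_measurable unit_square"
    using a unfolding kernels_def by (intro borel_measurable_add) blast+
  ultimately show ?thesis by (auto simp: kernels_def)
qed

lemma kernels_uminus: "f \<in> kernels \<Longrightarrow> (\<lambda>z. - f z) \<in> kernels"
  by (auto simp: kernels_def)

lemma kernels_diff: "f \<in> kernels \<Longrightarrow> g \<in> kernels \<Longrightarrow> (\<lambda>z. f z - g z) \<in> kernels"
  using kernels_add[of f "\<lambda>z. - g z"] kernels_uminus[of g] by simp

definition box_integral :: "(real \<times> real \<Rightarrow> real) \<Rightarrow> real set \<Rightarrow> real set \<Rightarrow> real" where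
  "box_integral f S T = (\<integral>z. indicator (S \<times> T) z * f z \<partial>unit_square)"

abbreviation unit_sets :: "real set set" where
  "unit_sets \<equiv> {S \<in> sets borel. S \<subseteq> {0..1}}"

lemma unit_sets_eq: "unit_sets = sets unit_interval"
  by (rule set_eqI) (simp add: sets_restrict_space_iff conj_commute)

lemma set_integral_box:
  assumes "S \<in> unit_sets" "T \<in> unit_sets"
  shows "(LINT z : S \<times> T | lborel. f z) = box_integral f S T"
proof -
  have "indicator (S \<times> T) z *\<^sub>R f z =
      indicator ({0..1} \<times> {0..1}) z *\<^sub>R (indicator (S \<times> T) z * f z)" for z
    using assms by (auto simp: indicator_def)
  then have "(LINT z : S \<times> T | lborel. f z) =
      (\<integral>z. indicator ({0..1} \<times> {0..1}) z *\<^sub>R (indicator (S \<times> T) z * f z) \<partial>lborel)"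
    unfolding set_lebesgue_integral_def by (rule Bochner_Integration.integral_cong[OF refl])
  also have "\<dots> = box_integral f S T"
    unfolding box_integral_def unit_square_eq
    by (rule integral_restrict_space[symmetric]) (simp add: borel_Times)
  finally show ?thesis .
qed

lemma cut_norm_eq:
  "cut_norm f = (SUP (S, T) \<in> unit_sets \<times> unit_sets. \<bar>box_integral f S T\<bar>)"
  unfolding cut_norm_def
  by (rule arg_cong[where f = Sup], rule image_cong) (auto simp: set_integral_box)

lemma integrable_box:
  assumes "f \<in> kernels" "S \<in> unit_sets" "T \<in> unit_sets"
  shows "integrable unit_square (\<lambda>z. indicator (S \<times> T) z * f z)"
proof -
  interpret prob_space unit_square by (rule prob_space_unit_square)
  obtain C where C: "\<forall>z \<in> {0..1} \<times> {0..1}. \<bar>f z\<bar> \<le> C" using assms by (auto simp: kernels_def)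
  have [measurable]: "f \<in> borel_measurable unit_square" using assms by (simp add: kernels_def)
  have [measurable]: "S \<times> T \<in> sets unit_square"
    using assms(2,3) unfolding unit_sets_eq by (rule pair_measureI)
  show ?thesis
  proof (rule integrable_const_bound[where B = C])
    have "0 \<le> C" using C[rule_format, of "(0, 0)"] by simp
    then show "AE z in unit_square. norm (indicator (S \<times> T) z * f z) \<le> C"
      using C by (intro AE_I2) (auto simp: indicator_def)
  qed simp
qed

lemma integrable_kernel:
  assumes "f \<in> kernels"
  shows "integrable unit_square f"
proof -
  have "integrable unit_square (\<lambda>z. indicator ({0..1} \<times> {0..1}) z * f z)"
    using assms by (rule integrable_box) auto
  then show ?thesis by (rule Bochner_Integration.integrable_cong[OF refl, THEN iffD1, rotated]) auto
qed

lemma box_integral_le_L1: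
  assumes "f \<in> kernels" "S \<in> unit_sets" "T \<in> unit_sets"
  shows "\<bar>box_integral f S T\<bar> \<le> (\<integral>z. \<bar>f z\<bar> \<partial>unit_square)"
proof -
  have "\<bar>box_integral f S T\<bar> \<le> (\<integral>z. \<bar>indicator (S \<times> T) z * f z\<bar> \<partial>unit_square)"
    unfolding box_integral_def by (rule integral_abs_bound)
  also have "\<dots> \<le> (\<integral>z. \<bar>f z\<bar> \<partial>unit_square)"
    using integrable_box[OF assms] integrable_kernel[OF assms(1)]
    by (intro integral_mono) (auto simp: indicator_def)
  finally show ?thesis .
qed

lemma box_integral_le_cut_norm:
  assumes "f \<in> kernels" "S \<in> unit_sets" "T \<in> unit_sets"
  shows "\<bar>box_integral f S T\<bar> \<le> cut_norm f"
  unfolding cut_norm_eq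
proof (rule cSUP_upper2[where x = "(S, T)"])
  show "bdd_above ((\<lambda>(S, T). \<bar>box_integral f S T\<bar>) ` (unit_sets \<times> unit_sets))"
    using box_integral_le_L1[OF assms(1)] by (intro bdd_aboveI2) auto
qed (use assms in auto)

lemma cut_norm_leI:
  assumes "\<And>S T. S \<in> unit_sets \<Longrightarrow> T \<in> unit_sets \<Longrightarrow> \<bar>box_integral f S T\<bar> \<le> c"
  shows "cut_norm f \<le> c"
  unfolding cut_norm_eq
proof (rule cSUP_least)
  have "({}, {}) \<in> unit_sets \<times> unit_sets" by simp
  then show "unit_sets \<times> unit_sets \<noteq> {}" by blast
qed (use assms in auto)

lemma cut_norm_le_L1: "f \<in> kernels \<Longrightarrow> cut_norm f \<le> (\<integral>z. \<bar>f z\<bar> \<partial>unit_square)"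
  by (intro cut_norm_leI box_integral_le_L1)

lemma cut_norm_nonneg: "f \<in> kernels \<Longrightarrow> 0 \<le> cut_norm f"
  using box_integral_le_cut_norm[of f "{}" "{}"] by simp

lemma cut_norm_triangle:
  assumes "f \<in> kernels" "g \<in> kernels"
  shows "cut_norm (\<lambda>z. f z + g z) \<le> cut_norm f + cut_norm g"
proof (rule cut_norm_leI)
  fix S T assume ST: "S \<in> unit_sets" "T \<in> unit_sets"
  have "box_integral (\<lambda>z. f z + g z) S T = box_integral f S T + box_integral g S T"
    unfolding box_integral_def using assms ST
    by (simp add: distrib_left integrable_box)
  then show "\<bar>box_integral (\<lambda>z. f z + g z) S T\<bar> \<le> cut_norm f + cut_norm g"
    using box_integral_le_cut_norm[OF assms(1) ST] box_integral_le_cut_norm[OF assms(2) ST]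
    by linarith
qed

lemma cut_norm_uminus: "cut_norm (\<lambda>z. - f z) = cut_norm f"
  by (simp add: cut_norm_eq box_integral_def)

definition relabel :: "(real \<Rightarrow> real) \<Rightarrow> (real \<times> real \<Rightarrow> real) \<Rightarrow> real \<times> real \<Rightarrow> real" where
  "relabel \<phi> f = (\<lambda>(x, y). f (\<phi> x, \<phi> y))"

lemma cut_distance_eq:
  "cut_distance U W = (INF \<phi> \<in> measure_preserving_bijections. cut_norm (\<lambda>z. U z - relabel \<phi> W z))"
  by (simp add: cut_distance_def relabel_def case_prod_unfold)

lemma measure_preserving_range: "\<phi> \<in> measure_preserving_bijections \<Longrightarrow> x \<in> {0..1} \<Longrightarrow> \<phi> x \<in> {0..1}"
  by (auto simp: measure_preserving_bijections_def bij_betw_def)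

lemma measure_preserving_square:
  assumes "\<phi> \<in> measure_preserving_bijections"
  shows "(\<lambda>(x, y). (\<phi> x, \<phi> y)) \<in> unit_square \<rightarrow>\<^sub>M unit_square"
    and "distr unit_square unit_square (\<lambda>(x, y). (\<phi> x, \<phi> y)) = unit_square"
proof -
  have [measurable]: "\<phi> \<in> unit_interval \<rightarrow>\<^sub>M unit_interval"
    and d: "distr unit_interval unit_interval \<phi> = unit_interval"
    using assms by (auto simp: measure_preserving_bijections_def)
  show "(\<lambda>(x, y). (\<phi> x, \<phi> y)) \<in> unit_square \<rightarrow>\<^sub>M unit_square" by measurable
  show "distr unit_square unit_square (\<lambda>(x, y). (\<phi> x, \<phi> y)) = unit_square"
    using pair_measure_distr[of \<phi> unit_interval unit_interval \<phi> unit_interval unit_interval]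
    by (simp add: d prob_space_imp_sigma_finite prob_space_unit_interval)
qed

lemma relabel_kernels:
  assumes "\<phi> \<in> measure_preserving_bijections" "f \<in> kernels"
  shows "relabel \<phi> f \<in> kernels"
proof -
  obtain C where "\<forall>z \<in> {0..1} \<times> {0..1}. \<bar>f z\<bar> \<le> C" using assms by (auto simp: kernels_def)
  then have "\<forall>z \<in> {0..1} \<times> {0..1}. \<bar>relabel \<phi> f z\<bar> \<le> C"
    using measure_preserving_range[OF assms(1)] by (fastforce simp: relabel_def)
  moreover have "relabel \<phi> f \<in> borel_measurable unit_square"
    using measurable_compose[OF measure_preserving_square(1)[OF assms(1)], of f borel] assms(2)
    by (simp add: relabel_def kernels_def case_prod_unfold)
  ultimately show ?thesis unfolding kernels_def by blast
qed

lemma integral_relabel: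
  assumes "\<phi> \<in> measure_preserving_bijections" "f \<in> borel_measurable unit_square"
  shows "(\<integral>z. relabel \<phi> f z \<partial>unit_square) = (\<integral>z. f z \<partial>unit_square)"
proof -
  have "(\<integral>z. f z \<partial>unit_square) =
      (\<integral>z. f z \<partial>distr unit_square unit_square (\<lambda>(x, y). (\<phi> x, \<phi> y)))"
    by (simp only: measure_preserving_square(2)[OF assms(1)])
  also have "\<dots> = (\<integral>z. f ((\<lambda>(x, y). (\<phi> x, \<phi> y)) z) \<partial>unit_square)"
    by (rule integral_distr[OF measure_preserving_square(1)[OF assms(1)] assms(2)])
  finally show ?thesis by (simp add: relabel_def case_prod_unfold)
qed

lemma measure_preserving_the_inv_into:
  assumes "\<phi> \<in> measure_preserving_bijections"
  shows "the_inv_into {0..1} \<phi> \<in> measure_preserving_bijections"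
proof -
  define \<psi> where "\<psi> = the_inv_into {0..1} \<phi>"
  have meas: "\<phi> \<in> unit_interval \<rightarrow>\<^sub>M unit_interval" "\<psi> \<in> unit_interval \<rightarrow>\<^sub>M unit_interval"
    and bij: "bij_betw \<phi> {0..1} {0..1}"
    and d: "distr unit_interval unit_interval \<phi> = unit_interval"
    using assms by (auto simp: measure_preserving_bijections_def \<psi>_def)
  have inj: "inj_on \<phi> {0..1}" and im: "\<phi> ` {0..1} = {0..1}" using bij by (auto simp: bij_betw_def)
  have bij': "bij_betw \<psi> {0..1} {0..1}"
    unfolding \<psi>_def using bij by (rule bij_betw_the_inv_into)
  have \<psi>\<phi>: "\<psi> (\<phi> x) = x" if "x \<in> {0..1}" for x
    unfolding \<psi>_def using inj that by (rule the_inv_into_f_f)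
  have inv: "the_inv_into {0..1} \<psi> x = \<phi> x" if "x \<in> {0..1}" for x
  proof (rule the_inv_into_f_eq)
    show "inj_on \<psi> {0..1}" using bij' by (rule bij_betw_imp_inj_on)
    show "\<psi> (\<phi> x) = x" "\<phi> x \<in> {0..1}" using that im by (auto simp: \<psi>\<phi>)
  qed
  have "the_inv_into {0..1} \<psi> \<in> unit_interval \<rightarrow>\<^sub>M unit_interval"
    using meas(1) by (subst measurable_cong[where g = \<phi>]) (simp_all add: inv)
  moreover have "distr unit_interval unit_interval \<psi> = unit_interval"
  proof -
    have "distr unit_interval unit_interval \<psi>
        = distr (distr unit_interval unit_interval \<phi>) unit_interval \<psi>"
      by (simp add: d)
    also have "\<dots> = distr unit_interval unit_interval (\<psi> \<circ> \<phi>)"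
      using meas by (simp add: distr_distr)
    also have "\<dots> = distr unit_interval unit_interval (\<lambda>x. x)"
      by (rule distr_cong) (auto simp: \<psi>\<phi>)
    finally show ?thesis by (simp add: distr_id)
  qed
  ultimately show ?thesis
    using meas bij' by (simp add: measure_preserving_bijections_def \<psi>_def)
qed

lemma measure_preserving_comp:
  assumes "\<phi> \<in> measure_preserving_bijections" "\<psi> \<in> measure_preserving_bijections"
  shows "\<psi> \<circ> \<phi> \<in> measure_preserving_bijections"
proof -
  have m: "\<phi> \<in> unit_interval \<rightarrow>\<^sub>M unit_interval" "\<psi> \<in> unit_interval \<rightarrow>\<^sub>M unit_interval"
    "the_inv_into {0..1} \<phi> \<in> unit_interval \<rightarrow>\<^sub>M unit_interval"
    "the_inv_into {0..1} \<psi> \<in> unit_interval \<rightarrow>\<^sub>M unit_interval"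
    and bij: "bij_betw \<phi> {0..1} {0..1}" "bij_betw \<psi> {0..1} {0..1}"
    and d: "distr unit_interval unit_interval \<phi> = unit_interval"
      "distr unit_interval unit_interval \<psi> = unit_interval"
    using assms by (auto simp: measure_preserving_bijections_def)
  have bij': "bij_betw (\<psi> \<circ> \<phi>) {0..1} {0..1}" using bij by (rule bij_betw_trans)
  have inv: "the_inv_into {0..1} (\<psi> \<circ> \<phi>) x = the_inv_into {0..1} \<phi> (the_inv_into {0..1} \<psi> x)"
    if "x \<in> {0..1}" for x
  proof (rule the_inv_into_f_eq)
    show "inj_on (\<psi> \<circ> \<phi>) {0..1}" using bij' by (rule bij_betw_imp_inj_on)
    have "the_inv_into {0..1} \<psi> x \<in> {0..1}" "\<psi> (the_inv_into {0..1} \<psi> x) = x"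
      using that bij(2) bij_betw_the_inv_into[OF bij(2)]
      by (auto simp: f_the_inv_into_f_bij_betw dest: bij_betwE)
    then show "(\<psi> \<circ> \<phi>) (the_inv_into {0..1} \<phi> (the_inv_into {0..1} \<psi> x)) = x"
      "the_inv_into {0..1} \<phi> (the_inv_into {0..1} \<psi> x) \<in> {0..1}"
      using bij(1) bij_betwE[OF bij_betw_the_inv_into[OF bij(1)]]
      by (auto simp: f_the_inv_into_f_bij_betw)
  qed
  have "the_inv_into {0..1} \<phi> \<circ> the_inv_into {0..1} \<psi> \<in> unit_interval \<rightarrow>\<^sub>M unit_interval"
    using m(4,3) by (rule measurable_comp)
  then have "the_inv_into {0..1} (\<psi> \<circ> \<phi>) \<in> unit_interval \<rightarrow>\<^sub>M unit_interval"
    by (subst measurable_cong[where g = "the_inv_into {0..1} \<phi> \<circ> the_inv_into {0..1} \<psi>"])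
      (simp_all add: inv)
  moreover have "distr unit_interval unit_interval (\<psi> \<circ> \<phi>) = unit_interval"
    using distr_distr[OF m(2,1)] by (simp add: d)
  moreover have "\<psi> \<circ> \<phi> \<in> unit_interval \<rightarrow>\<^sub>M unit_interval" using m(1,2) by (rule measurable_comp)
  ultimately show ?thesis using bij' by (simp add: measure_preserving_bijections_def)
qed

lemma measure_preserving_id: "(\<lambda>x. x) \<in> measure_preserving_bijections"
proof -
  have "the_inv_into {0..1} (\<lambda>x. x) \<in> unit_interval \<rightarrow>\<^sub>M unit_interval"
    by (subst measurable_cong[where g = "\<lambda>x. x"])
      (auto intro!: the_inv_into_f_eq simp: inj_on_def)
  then show ?thesis
    by (auto simp: measure_preserving_bijections_def distr_id bij_betw_def)
qed

text \<open>
  A box \<open>S \<times> T\<close> pulls back to a box along a bijection acting on both coordinates, so every value in the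
  supremum on the left also occurs on the right. For this the inverse bijection has to be
  measurable, since the box needed is the image of the given one.
\<close>
lemma cut_norm_relabel_le:
  assumes \<phi>: "\<phi> \<in> measure_preserving_bijections" and f: "f \<in> kernels"
  shows "cut_norm (relabel \<phi> f) \<le> cut_norm f"
proof (rule cut_norm_leI)
  fix S T assume ST: "S \<in> unit_sets" "T \<in> unit_sets"
  define \<psi> where "\<psi> = the_inv_into {0..1} \<phi>"
  have \<psi>: "\<psi> \<in> unit_interval \<rightarrow>\<^sub>M unit_interval" and inj: "inj_on \<phi> {0..1}"
    using \<phi> by (auto simp: measure_preserving_bijections_def \<psi>_def bij_betw_def)
  define im where "im A = \<psi> -` A \<inter> {0..1}" for A
  have im: "im A \<in> unit_sets" if "A \<in> unit_sets" for A
    using measurable_sets[OF \<psi>, of A] that unfolding unit_sets_eq by (simp add: im_def)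
  have mem: "\<phi> x \<in> im A \<longleftrightarrow> x \<in> A" if "x \<in> {0..1}" for x A
    using that the_inv_into_f_f[OF inj] measure_preserving_range[OF \<phi>] by (auto simp: im_def \<psi>_def)
  have "box_integral (relabel \<phi> f) S T =
      (\<integral>z. relabel \<phi> (\<lambda>z. indicator (im S \<times> im T) z * f z) z \<partial>unit_square)"
    unfolding box_integral_def
    by (rule Bochner_Integration.integral_cong) (auto simp: relabel_def indicator_def mem)
  also have "\<dots> = box_integral f (im S) (im T)"
    unfolding box_integral_def
    by (rule integral_relabel[OF \<phi> borel_measurable_integrable[OF integrable_box]])
      (use im ST f in blast)+
  finally show "\<bar>box_integral (relabel \<phi> f) S T\<bar> \<le> cut_norm f"
    using box_integral_le_cut_norm[OF f im[OF ST(1)] im[OF ST(2)]] by simp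
qed

lemma cut_norm_cong:
  assumes "\<And>x y. x \<in> {0..1} \<Longrightarrow> y \<in> {0..1} \<Longrightarrow> f (x, y) = g (x, y)"
  shows "cut_norm f = cut_norm g"
proof -
  have "box_integral f = box_integral g"
    unfolding box_integral_def fun_eq_iff
    by (intro allI Bochner_Integration.integral_cong) (auto simp: assms)
  then show ?thesis by (simp add: cut_norm_eq)
qed

lemma cut_distance_bdd_below:
  assumes "U \<in> kernels" "W \<in> kernels"
  shows "bdd_below ((\<lambda>\<phi>. cut_norm (\<lambda>z. U z - relabel \<phi> W z)) ` measure_preserving_bijections)"
  using assms by (intro bdd_belowI2[where m = 0] cut_norm_nonneg kernels_diff relabel_kernels)

lemma cut_distance_le:
  assumes "U \<in> kernels" "W \<in> kernels" "\<phi> \<in> measure_preserving_bijections"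
  shows "cut_distance U W \<le> cut_norm (\<lambda>z. U z - relabel \<phi> W z)"
  unfolding cut_distance_eq using assms by (intro cINF_lower cut_distance_bdd_below)

lemma cut_distance_geI:
  assumes "\<And>\<phi>. \<phi> \<in> measure_preserving_bijections \<Longrightarrow> c \<le> cut_norm (\<lambda>z. U z - relabel \<phi> W z)"
  shows "c \<le> cut_distance U W"
  unfolding cut_distance_eq using assms measure_preserving_id by (intro cINF_greatest) auto

lemma cut_distance_nonneg: "U \<in> kernels \<Longrightarrow> W \<in> kernels \<Longrightarrow> 0 \<le> cut_distance U W"
  by (intro cut_distance_geI cut_norm_nonneg kernels_diff relabel_kernels)

lemma cut_distance_refl:
  assumes "W \<in> kernels"
  shows "cut_distance W W = 0"
proof (rule antisym)
  have "cut_distance W W \<le> cut_norm (\<lambda>z. W z - relabel (\<lambda>x. x) W z)"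
    by (intro cut_distance_le assms measure_preserving_id)
  also have "\<dots> \<le> 0" by (rule cut_norm_leI) (simp add: relabel_def box_integral_def)
  finally show "cut_distance W W \<le> 0" .
qed (intro cut_distance_nonneg assms)

text \<open>
  Relabelling by the inverse of \<open>\<phi>\<close> turns \<open>W - U \<circ> \<phi>\<close> into the negative of \<open>U - W \<circ> \<phi>\<^sup>-\<^sup>1\<close>.
\<close>
lemma cut_distance_sym_le:
  assumes "U \<in> kernels" "W \<in> kernels"
  shows "cut_distance U W \<le> cut_distance W U"
proof (rule cut_distance_geI)
  fix \<phi> assume \<phi>: "\<phi> \<in> measure_preserving_bijections"
  define \<psi> where "\<psi> = the_inv_into {0..1} \<phi>"
  have \<psi>: "\<psi> \<in> measure_preserving_bijections" unfolding \<psi>_def by (rule measure_preserving_the_inv_into[OF \<phi>])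
  have inv: "\<phi> (\<psi> x) = x" if "x \<in> {0..1}" for x
    unfolding \<psi>_def using \<phi> that
    by (intro f_the_inv_into_f) (auto simp: measure_preserving_bijections_def bij_betw_def)
  have "cut_distance U W \<le> cut_norm (\<lambda>z. U z - relabel \<psi> W z)"
    by (rule cut_distance_le[OF assms \<psi>])
  also have "\<dots> = cut_norm (\<lambda>z. relabel \<psi> W z - U z)"
    by (subst cut_norm_uminus[symmetric]) simp
  also have "\<dots> = cut_norm (relabel \<psi> (\<lambda>z. W z - relabel \<phi> U z))"
    by (rule cut_norm_cong) (simp add: relabel_def inv)
  also have "\<dots> \<le> cut_norm (\<lambda>z. W z - relabel \<phi> U z)"
    by (intro cut_norm_relabel_le \<psi> kernels_diff relabel_kernels assms \<phi>)
  finally show "cut_distance U W \<le> cut_norm (\<lambda>z. W z - relabel \<phi> U z)" .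
qed

lemma cut_distance_sym:
  "U \<in> kernels \<Longrightarrow> W \<in> kernels \<Longrightarrow> cut_distance U W = cut_distance W U"
  by (intro antisym cut_distance_sym_le)

text \<open>
  Bijections that align \<open>U\<close> with \<open>V\<close> and \<open>V\<close> with \<open>W\<close> compose to one that aligns \<open>U\<close> with \<open>W\<close>, and
  the second error is unchanged by relabelling with the first bijection.
\<close>
lemma cut_distance_triangle:
  assumes "U \<in> kernels" "V \<in> kernels" "W \<in> kernels"
  shows "cut_distance U W \<le> cut_distance U V + cut_distance V W"
proof -
  have "cut_distance U W \<le> cut_norm (\<lambda>z. U z - relabel \<phi> V z) + cut_norm (\<lambda>z. V z - relabel \<psi> W z)"
    if \<phi>: "\<phi> \<in> measure_preserving_bijections" and \<psi>: "\<psi> \<in> measure_preserving_bijections" for \<phi> \<psi>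
  proof -
    have "cut_distance U W \<le> cut_norm (\<lambda>z. U z - relabel (\<psi> \<circ> \<phi>) W z)"
      by (intro cut_distance_le assms measure_preserving_comp \<phi> \<psi>)
    also have "(\<lambda>z. U z - relabel (\<psi> \<circ> \<phi>) W z) =
        (\<lambda>z. (U z - relabel \<phi> V z) + relabel \<phi> (\<lambda>z. V z - relabel \<psi> W z) z)"
      by (auto simp: relabel_def)
    also have "cut_norm \<dots> \<le> cut_norm (\<lambda>z. U z - relabel \<phi> V z)
        + cut_norm (relabel \<phi> (\<lambda>z. V z - relabel \<psi> W z))"
      by (intro cut_norm_triangle kernels_diff relabel_kernels assms \<phi> \<psi>)
    also have "cut_norm (relabel \<phi> (\<lambda>z. V z - relabel \<psi> W z)) \<le> cut_norm (\<lambda>z. V z - relabel \<psi> W z)"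
      by (intro cut_norm_relabel_le kernels_diff relabel_kernels assms \<phi> \<psi>)
    finally show ?thesis by simp
  qed
  then have "cut_distance U W - cut_norm (\<lambda>z. U z - relabel \<phi> V z) \<le> cut_distance V W"
    if "\<phi> \<in> measure_preserving_bijections" for \<phi>
    using that by (intro cut_distance_geI) (simp add: algebra_simps)
  then have "cut_distance U W - cut_distance V W \<le> cut_distance U V"
    by (intro cut_distance_geI) (simp add: algebra_simps)
  then show ?thesis by simp
qed

section \<open>Measurability of limits in the cut distance\<close>

text \<open>
  The limit lies in an open set iff, for some radius, the approximations eventually stay at this
  distance from the complement. The sets of graphons at such a distance are arbitrary, so measurability
  comes from the discreteness of the approximations, whose preimages are all measurable.
\<close>
lemma measurable_graphon_limit:
  fixes S :: "nat \<Rightarrow> 'a \<Rightarrow> real \<times> real \<Rightarrow> real"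
  assumes discrete: "\<And>n X. {\<omega> \<in> space M. S n \<omega> \<in> X} \<in> sets M"
    and kernel: "\<And>n \<omega>. \<omega> \<in> space M \<Longrightarrow> S n \<omega> \<in> kernels"
    and graphon: "\<And>\<omega>. \<omega> \<in> space M \<Longrightarrow> W \<omega> \<in> graphons"
    and lim: "\<And>\<omega>. \<omega> \<in> space M \<Longrightarrow> (\<lambda>n. cut_distance (S n \<omega>) (W \<omega>)) \<longlonglongrightarrow> 0"
  shows "W \<in> M \<rightarrow>\<^sub>M graphon_borel"
  unfolding graphon_borel_def
proof (rule measurable_measure_of)
  fix X assume "X \<in> {X. X \<subseteq> graphons \<and>
    (\<forall>U\<in>X. \<exists>\<epsilon>>0. \<forall>W\<in>graphons. cut_distance U W < \<epsilon> \<longrightarrow> W \<in> X)}"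
  then have X: "X \<subseteq> graphons"
    "\<And>U. U \<in> X \<Longrightarrow> \<exists>\<epsilon>>0. \<forall>W\<in>graphons. cut_distance U W < \<epsilon> \<longrightarrow> W \<in> X" by auto
  define core where "core k = {U. \<forall>Z\<in>graphons. cut_distance U Z < 1 / Suc k \<longrightarrow> Z \<in> X}" for k :: nat
  have "W \<omega> \<in> X \<longleftrightarrow> (\<exists>k N. \<forall>n\<ge>N. S n \<omega> \<in> core k)" if \<omega>: "\<omega> \<in> space M" for \<omega>
  proof
    assume "W \<omega> \<in> X"
    then obtain \<epsilon> where \<epsilon>: "\<epsilon> > 0" "\<And>Z. Z \<in> graphons \<Longrightarrow> cut_distance (W \<omega>) Z < \<epsilon> \<Longrightarrow> Z \<in> X"
      using X(2) by blast
    then obtain k :: nat where k: "1 / Suc k < \<epsilon> / 2"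
      using nat_approx_posE[of "\<epsilon> / 2"] by auto
    have "\<forall>\<^sub>F n in sequentially. cut_distance (S n \<omega>) (W \<omega>) < \<epsilon> / 2"
      using lim[OF \<omega>] \<epsilon>(1) by (intro order_tendstoD) auto
    then obtain N where N: "\<And>n. n \<ge> N \<Longrightarrow> cut_distance (S n \<omega>) (W \<omega>) < \<epsilon> / 2"
      by (auto simp: eventually_sequentially)
    have "S n \<omega> \<in> core k" if "n \<ge> N" for n
      unfolding core_def
    proof (intro CollectI ballI impI \<epsilon>(2))
      fix Z assume Z: "Z \<in> graphons" "cut_distance (S n \<omega>) Z < 1 / Suc k"
      have "cut_distance (W \<omega>) Z \<le> cut_distance (W \<omega>) (S n \<omega>) + cut_distance (S n \<omega>) Z"
        using Z \<omega> graphons_subset_kernels graphon kernel by (intro cut_distance_triangle) auto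
      also have "cut_distance (W \<omega>) (S n \<omega>) = cut_distance (S n \<omega>) (W \<omega>)"
        using \<omega> graphons_subset_kernels graphon kernel by (intro cut_distance_sym) auto
      finally show "cut_distance (W \<omega>) Z < \<epsilon>" using N[OF that] Z(2) k by linarith
    qed
    then show "\<exists>k N. \<forall>n\<ge>N. S n \<omega> \<in> core k" by blast
  next
    assume "\<exists>k N. \<forall>n\<ge>N. S n \<omega> \<in> core k"
    then obtain k N where kN: "\<And>n. n \<ge> N \<Longrightarrow> S n \<omega> \<in> core k" by blast
    have "\<forall>\<^sub>F n in sequentially. cut_distance (S n \<omega>) (W \<omega>) < 1 / Suc k"
      using lim[OF \<omega>] by (intro order_tendstoD) auto
    then obtain N' where "\<And>n. n \<ge> N' \<Longrightarrow> cut_distance (S n \<omega>) (W \<omega>) < 1 / Suc k"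
      by (auto simp: eventually_sequentially)
    then have "cut_distance (S (max N N') \<omega>) (W \<omega>) < 1 / Suc k" by simp
    with kN[of "max N N'"] graphon[OF \<omega>] show "W \<omega> \<in> X" by (simp add: core_def)
  qed
  then have "W -` X \<inter> space M = {\<omega> \<in> space M. \<exists>k N. \<forall>n\<in>{N..}. S n \<omega> \<in> core k}"
    unfolding Ball_def atLeast_iff by blast
  also have "\<dots> \<in> sets M"
    by (intro sets.sets_Collect_countable_Ex sets.sets_Collect_countable_Ball discrete)
  finally show "W -` X \<inter> space M \<in> sets M" .
qed (use graphon in auto)

section \<open>The cographon of a sequence of labelled points\<close>

text \<open>
  The interval is open on the left because a new vertex is inserted to the right of its parent: a
  vertex separates itself from everything to its left, but not from what lies to its right.
  The same predicate serves for ranks (natural numbers) and for points of the unit interval.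
\<close>
definition separates :: "'o::linorder \<Rightarrow> 'o \<Rightarrow> 'o \<Rightarrow> bool" where
  "separates t x y \<longleftrightarrow> x < t \<and> t \<le> y \<or> y < t \<and> t \<le> x"

text \<open>
  The absence of a separating point counts as a negative label. This is the value on the diagonal, in
  accordance with the absence of loops.
\<close>
definition first_label :: "(nat \<Rightarrow> 'o::linorder) \<Rightarrow> (nat \<Rightarrow> bool) \<Rightarrow> 'o \<Rightarrow> 'o \<Rightarrow> bool" where
  "first_label u b x y \<longleftrightarrow>
     (\<exists>m. b m \<and> separates (u m) x y \<and> (\<forall>l<m. \<not> separates (u l) x y))"

definition cographon :: "(nat \<Rightarrow> real) \<Rightarrow> (nat \<Rightarrow> bool) \<Rightarrow> real \<times> real \<Rightarrow> real" where
  "cographon u b = (\<lambda>(x, y). of_bool (first_label u b x y))"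

lemma separates_sym: "separates t x y \<longleftrightarrow> separates t y x"
  by (auto simp: separates_def)

lemma not_separates_refl [simp]: "\<not> separates t x x"
  by (auto simp: separates_def)

lemma first_label_sym: "first_label u b x y \<longleftrightarrow> first_label u b y x"
  by (simp add: first_label_def separates_sym[of _ x y])

lemma first_label_iff:
  assumes "separates (u m) x y" "\<And>l. l < m \<Longrightarrow> \<not> separates (u l) x y"
  shows "first_label u b x y \<longleftrightarrow> b m"
  unfolding first_label_def using assms by (metis linorder_neqE_nat)

lemma cographon_graphon: "cographon u b \<in> graphons"
proof (rule graphonsI)
  show "cographon u b \<in> borel_measurable unit_square"
    unfolding cographon_def first_label_def separates_def case_prod_unfold by measurable
qed (auto simp: cographon_def first_label_sym)

text \<open>
  If \<open>m\<close> is the first index with a limit point separating \<open>x\<close> from \<open>y\<close>, then only the finitely many points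
  with index at most \<open>m\<close> matter, and each of them ends up on the same side of \<open>x\<close> and of \<open>y\<close> as its
  limit.
\<close>
lemma eventually_first_label_eq:
  fixes x y :: real
  assumes lim: "\<And>m. (\<lambda>n. u n m) \<longlonglongrightarrow> U m"
    and "x \<notin> range U" "y \<notin> range U" and "separates (U m0) x y"
  shows "\<forall>\<^sub>F n in sequentially. first_label (u n) b x y = first_label U b x y"
proof -
  define m where "m = (LEAST m. separates (U m) x y)"
  have m: "separates (U m) x y" "\<And>l. l < m \<Longrightarrow> \<not> separates (U l) x y"
    using assms(4) by (auto simp: m_def intro: LeastI dest: not_less_Least)
  have "\<forall>\<^sub>F n in sequentially. separates (u n l) x y = separates (U l) x y" for l
  proof -
    have side: "\<forall>\<^sub>F n in sequentially. (c < u n l \<longleftrightarrow> c < U l) \<and> (u n l \<le> c \<longleftrightarrow> U l \<le> c)"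
      if "c \<notin> range U" for c
    proof (cases "c < U l")
      case True
      then show ?thesis using order_tendstoD(1)[OF lim True] by (auto elim: eventually_mono)
    next
      case False
      then have "U l < c" using that by (metis linorder_neqE_linordered_idom rangeI)
      then show ?thesis using order_tendstoD(2)[OF lim \<open>U l < c\<close>] by (auto elim: eventually_mono)
    qed
    show ?thesis
      using side[OF assms(2)] side[OF assms(3)] by eventually_elim (simp add: separates_def)
  qed
  then have "\<forall>\<^sub>F n in sequentially. \<forall>l\<in>{..m}. separates (u n l) x y = separates (U l) x y"
    by (intro eventually_ball_finite) auto
  then show ?thesis
  proof eventually_elim
    case (elim n)
    then show ?case using m first_label_iff[of U m x y b] first_label_iff[of "u n" m x y b] by auto
  qed
qed

text \<open>
  Density guarantees that every two distinct points are separated. The exceptional coordinates, where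
  the membership in an interval may fail to stabilise, are the countably many limit points.
\<close>
lemma tendsto_cographon_L1:
  assumes lim: "\<And>m. (\<lambda>n. u n m) \<longlonglongrightarrow> U m"
    and dense: "\<And>x y. 0 \<le> x \<Longrightarrow> x < y \<Longrightarrow> y \<le> 1 \<Longrightarrow> \<exists>m. x < U m \<and> U m < y"
  shows "(\<lambda>n. \<integral>z. \<bar>cographon (u n) b z - cographon U b z\<bar> \<partial>unit_square) \<longlonglongrightarrow> 0"
proof -
  interpret prob_space unit_square by (rule prob_space_unit_square)
  have [measurable]: "cographon v b \<in> borel_measurable unit_square" for v
    by (intro graphons_measurable cographon_graphon)
  have "AE z in unit_square. fst z \<notin> range U \<and> snd z \<notin> range U"
    by (rule AE_unit_square_avoids_countable) simp
  then have ae: "AE z in unit_square.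
      (\<lambda>n. \<bar>cographon (u n) b z - cographon U b z\<bar>) \<longlonglongrightarrow> 0"
  proof (rule AE_mp[OF _ AE_I2], intro impI)
    fix z assume z: "z \<in> space unit_square" "fst z \<notin> range U \<and> snd z \<notin> range U"
    obtain x y where xy: "z = (x, y)" by (cases z)
    have "\<forall>\<^sub>F n in sequentially. first_label (u n) b x y = first_label U b x y"
    proof (cases "x = y")
      case True
      then show ?thesis by (simp add: first_label_def)
    next
      case False
      then have "\<exists>m. separates (U m) x y"
        using dense[of "min x y" "max x y"] z(1) xy
        by (fastforce simp: separates_def min_def max_def split: if_splits)
      then obtain m where "separates (U m) x y" ..
      then show ?thesis
        by (intro eventually_first_label_eq[OF lim]) (use z(2) xy in auto)
    qed
    then have "\<forall>\<^sub>F n in sequentially. \<bar>cographon (u n) b z - cographon U b z\<bar> = 0"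
      by eventually_elim (simp add: cographon_def xy)
    then show "(\<lambda>n. \<bar>cographon (u n) b z - cographon U b z\<bar>) \<longlonglongrightarrow> 0"
      by (rule tendsto_eventually)
  qed
  have bound: "\<bar>cographon v b z - cographon w b z\<bar> \<le> 1" for v w z
    by (cases z) (simp add: cographon_def)
  have "(\<lambda>n. \<integral>z. \<bar>cographon (u n) b z - cographon U b z\<bar> \<partial>unit_square)
      \<longlonglongrightarrow> (\<integral>z. 0 \<partial>unit_square)"
    by (rule integral_dominated_convergence[where w = "\<lambda>_. 1"])
      (use ae bound in auto)
  then show ?thesis by simp
qed

section \<open>Permuting the blocks of a step graphon\<close>

definition block :: "nat \<Rightarrow> real \<Rightarrow> nat" where
  "block n x = nat \<lfloor>real n * x\<rfloor>"

definition permute_blocks :: "nat \<Rightarrow> (nat \<Rightarrow> nat) \<Rightarrow> real \<Rightarrow> real" where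
  "permute_blocks n \<sigma> x =
     (if 0 \<le> x \<and> x < 1 then x + (real (\<sigma> (block n x)) - real (block n x)) / real n else x)"

lemma block_eq_iff:
  assumes "0 < n" "0 \<le> x"
  shows "block n x = i \<longleftrightarrow> real i / n \<le> x \<and> x < (real i + 1) / n"
proof -
  have "block n x = i \<longleftrightarrow> \<lfloor>real n * x\<rfloor> = int i"
    using assms by (auto simp: block_def nat_eq_iff)
  then show ?thesis using assms by (simp add: floor_eq_iff field_simps)
qed

lemma block_less:
  assumes "0 < n" "0 \<le> x" "x < 1"
  shows "block n x < n"
proof -
  have "real (block n x) \<le> n * x" using assms by (simp add: block_def)
  also have "\<dots> < n" using assms by simp
  finally show ?thesis by simp
qed

text \<open>
  The block with number \<open>i\<close> is translated onto the block with number \<open>\<sigma> i\<close>.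
\<close>
lemma permute_blocks:
  assumes "0 < n" "\<sigma> ` {..<n} \<subseteq> {..<n}" "0 \<le> x" "x < 1"
  shows "0 \<le> permute_blocks n \<sigma> x" "permute_blocks n \<sigma> x < 1"
    and "block n (permute_blocks n \<sigma> x) = \<sigma> (block n x)"
proof -
  define i where "i = block n x"
  have i: "real i / n \<le> x" "x < (real i + 1) / n" "i < n"
    using block_eq_iff[of n x i] block_less[of n x] assms by (auto simp: i_def)
  have \<phi>: "permute_blocks n \<sigma> x = x + (real (\<sigma> i) - real i) / n"
    using assms by (simp add: permute_blocks_def i_def)
  have bounds: "real (\<sigma> i) / n \<le> permute_blocks n \<sigma> x" "permute_blocks n \<sigma> x < (real (\<sigma> i) + 1) / n"
    using i by (simp_all add: \<phi> diff_divide_distrib add_divide_distrib)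
  have "\<sigma> i < n" using assms(2) i(3) by auto
  then have "(real (\<sigma> i) + 1) / n \<le> 1" using assms(1) by (simp add: field_simps)
  with bounds(2) show "permute_blocks n \<sigma> x < 1" by simp
  have "0 \<le> real (\<sigma> i) / n" by simp
  with bounds(1) show pos: "0 \<le> permute_blocks n \<sigma> x" by linarith
  show "block n (permute_blocks n \<sigma> x) = \<sigma> (block n x)"
    using bounds by (simp add: block_eq_iff[OF assms(1) pos] i_def)
qed

lemma permute_blocks_inverse:
  assumes "0 < n" "\<sigma> ` {..<n} \<subseteq> {..<n}" "\<And>i. i < n \<Longrightarrow> \<tau> (\<sigma> i) = i"
  shows "permute_blocks n \<tau> (permute_blocks n \<sigma> x) = x"
proof (cases "0 \<le> x \<and> x < 1")
  case True
  then show ?thesis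
    using permute_blocks[OF assms(1,2), of x] block_less[OF assms(1), of x] assms(3)
    by (simp add: permute_blocks_def[of n \<tau>])
      (simp add: permute_blocks_def diff_divide_distrib)
qed (auto simp: permute_blocks_def)

lemma permute_blocks_measurable: "permute_blocks n \<sigma> \<in> borel_measurable borel"
proof -
  have [measurable]: "block n \<in> borel \<rightarrow>\<^sub>M count_space UNIV" unfolding block_def by measurable
  show ?thesis unfolding permute_blocks_def by measurable
qed

lemma emeasure_split_blocks:
  assumes "0 < n" "A \<in> sets borel" "A \<subseteq> {0..1}"
  shows "emeasure lborel A = (\<Sum>i<n. emeasure lborel (A \<inter> {real i / n ..< (real i + 1) / n}))"
proof -
  define I where "I i = {real i / n ..< (real i + 1) / n}" for i :: nat
  have I: "x \<in> I i \<longleftrightarrow> 0 \<le> x \<and> block n x = i" for x i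
  proof (cases "0 \<le> x")
    case False
    moreover have "0 \<le> real i / n" by simp
    ultimately show ?thesis unfolding I_def by (smt (verit) atLeastLessThan_iff)
  qed (simp add: I_def block_eq_iff[OF assms(1)])
  have "(\<Sum>i<n. emeasure lborel (A \<inter> I i)) = emeasure lborel (\<Union>i<n. A \<inter> I i)"
    using assms(2) by (intro sum_emeasure) (auto simp: disjoint_family_on_def I, auto simp: I_def)
  also have "(\<Union>i<n. A \<inter> I i) = A - {1}"
  proof -
    have "block n 1 = n" by (simp add: block_def)
    then show ?thesis using assms(3) block_less[OF assms(1)] by (fastforce simp: I)
  qed
  also have "emeasure lborel (A - {1}) = emeasure lborel A"
    using assms(2) by (intro emeasure_Diff_null_set) auto
  finally show ?thesis by (simp add: I_def)
qed

lemma emeasure_lborel_shift: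
  fixes c :: real
  assumes "A \<in> sets borel"
  shows "emeasure lborel ((\<lambda>x. x + c) -` A) = emeasure lborel A"
proof -
  have "emeasure lborel A = emeasure (distr lborel borel ((+) c)) A" by (simp add: lborel_distr_plus)
  also have "\<dots> = emeasure lborel ((+) c -` A)" using assms by (subst emeasure_distr) auto
  also have "(+) c = (\<lambda>x. x + c)" by (auto simp: add.commute)
  finally show ?thesis by simp
qed

text \<open>
  On each block the map is a translation, and the blocks are permuted, so a set and its preimage have
  the same measure block by block. The inverse is given by the inverse permutation.
\<close>
lemma permute_blocks_measure_preserving:
  assumes n: "0 < n" and bij: "bij_betw \<sigma> {..<n} {..<n}"
  shows "permute_blocks n \<sigma> \<in> measure_preserving_bijections"
proof -
  define \<phi> where "\<phi> = permute_blocks n \<sigma>"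
  define \<tau> where "\<tau> = the_inv_into {..<n} \<sigma>"
  define \<psi> where "\<psi> = permute_blocks n \<tau>"
  have bij': "bij_betw \<tau> {..<n} {..<n}" unfolding \<tau>_def using bij by (rule bij_betw_the_inv_into)
  have im: "\<sigma> ` {..<n} \<subseteq> {..<n}" "\<tau> ` {..<n} \<subseteq> {..<n}"
    using bij bij' by (auto simp: bij_betw_def)
  have \<tau>\<sigma>: "\<tau> (\<sigma> i) = i" "\<sigma> (\<tau> i) = i" if "i < n" for i
    using bij that
    by (auto simp: \<tau>_def f_the_inv_into_f_bij_betw bij_betw_def the_inv_into_f_f)
  have inv: "\<psi> (\<phi> x) = x" "\<phi> (\<psi> x) = x" for x
    unfolding \<phi>_def \<psi>_def using \<tau>\<sigma> im by (auto intro!: permute_blocks_inverse n)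
  have range: "permute_blocks n \<rho> x \<in> {0..1}" if "x \<in> {0..1}" "\<rho> ` {..<n} \<subseteq> {..<n}" for \<rho> x
  proof (cases "x < 1")
    case True
    then show ?thesis using permute_blocks(1,2)[OF n that(2), of x] that(1) by auto
  qed (use that in \<open>auto simp: permute_blocks_def\<close>)
  have meas: "permute_blocks n \<rho> \<in> unit_interval \<rightarrow>\<^sub>M unit_interval" if "\<rho> ` {..<n} \<subseteq> {..<n}" for \<rho>
  proof (rule measurable_restrict_space2)
    show "permute_blocks n \<rho> \<in> unit_interval \<rightarrow>\<^sub>M lborel"
      using permute_blocks_measurable by (intro measurable_restrict_space1) simp
  qed (use range[OF _ that] in auto)
  have \<phi>bij: "bij_betw \<phi> {0..1} {0..1}"
    by (rule bij_betw_byWitness[where f' = \<psi>])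
      (use inv range im in \<open>auto simp: \<phi>_def \<psi>_def\<close>)
  have "the_inv_into {0..1} \<phi> x = \<psi> x" if "x \<in> {0..1}" for x
    using \<phi>bij range[OF that im(2)] inv
    by (intro the_inv_into_f_eq) (auto simp: bij_betw_def \<psi>_def)
  then have "the_inv_into {0..1} \<phi> \<in> unit_interval \<rightarrow>\<^sub>M unit_interval"
    using meas[OF im(2)] by (subst measurable_cong[where g = \<psi>]) (simp_all add: \<psi>_def)
  moreover have "distr unit_interval unit_interval \<phi> = unit_interval"
  proof (rule measure_eqI)
    fix A assume "A \<in> sets (distr unit_interval unit_interval \<phi>)"
    then have A: "A \<in> sets borel" "A \<subseteq> {0..1}" "A \<in> sets unit_interval"
      using unit_sets_eq by auto
    define A' where "A' = \<phi> -` A \<inter> {0..1}"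
    have "A' \<in> sets unit_interval"
      using measurable_sets[OF meas[OF im(1)] A(3)] by (simp add: A'_def \<phi>_def)
    then have A': "A' \<in> sets borel" "A' \<subseteq> {0..1}" using unit_sets_eq by auto
    define I where "I i = {real i / n ..< (real i + 1) / n}" for i :: nat
    have I: "I i \<subseteq> {0..<1}" if "i < n" for i
    proof -
      have "0 \<le> real i / n" "(real i + 1) / n \<le> 1" using that by (auto simp: field_simps)
      then show ?thesis unfolding I_def by (smt (verit) atLeastLessThan_iff subsetI)
    qed
    have shift: "A' \<inter> I i = (\<lambda>x. x + (real (\<sigma> i) - real i) / n) -` (A \<inter> I (\<sigma> i))"
      if "i < n" for i
    proof -
      have mem: "x \<in> I i \<longleftrightarrow> x + (real (\<sigma> i) - real i) / n \<in> I (\<sigma> i)" for x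
        by (auto simp: I_def diff_divide_distrib add_divide_distrib)
      have \<phi>: "\<phi> x = x + (real (\<sigma> i) - real i) / n" if "x \<in> I i" for x
      proof -
        have "0 \<le> x" "x < 1" using that I[OF \<open>i < n\<close>] by auto
        moreover have "block n x = i"
          using that \<open>0 \<le> x\<close> by (simp add: block_eq_iff[OF n] I_def)
        ultimately show ?thesis by (simp add: \<phi>_def permute_blocks_def)
      qed
      have "x \<in> A' \<inter> I i \<longleftrightarrow> x + (real (\<sigma> i) - real i) / n \<in> A \<inter> I (\<sigma> i)" for x
      proof (cases "x \<in> I i")
        case True
        then have "x \<in> {0..1}" using I[OF that] by auto
        with True mem[of x] \<phi>[OF True] show ?thesis by (simp add: A'_def)
      qed (use mem[of x] in simp)
      then show ?thesis by blast
    qed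
    have "emeasure lborel A' = (\<Sum>i<n. emeasure lborel (A' \<inter> I i))"
      unfolding I_def by (rule emeasure_split_blocks[OF n A'])
    also have "\<dots> = (\<Sum>i<n. emeasure lborel (A \<inter> I (\<sigma> i)))"
    proof (intro sum.cong refl)
      fix i assume "i \<in> {..<n}"
      then have "A' \<inter> I i = (\<lambda>x. x + (real (\<sigma> i) - real i) / n) -` (A \<inter> I (\<sigma> i))"
        using shift by simp
      moreover have "A \<inter> I (\<sigma> i) \<in> sets borel" using A(1) by (auto simp: I_def)
      ultimately show "emeasure lborel (A' \<inter> I i) = emeasure lborel (A \<inter> I (\<sigma> i))"
        by (simp only: emeasure_lborel_shift)
    qed
    also have "\<dots> = (\<Sum>i<n. emeasure lborel (A \<inter> I i))"
      by (rule sum.reindex_bij_betw[OF bij])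
    also have "\<dots> = emeasure lborel A"
      unfolding I_def by (rule emeasure_split_blocks[OF n A(1,2), symmetric])
    finally have "emeasure lborel A' = emeasure lborel A" .
    then show "emeasure (distr unit_interval unit_interval \<phi>) A = emeasure unit_interval A"
      using meas[OF im(1)] A A'
      by (simp add: emeasure_distr emeasure_restrict_space A'_def[symmetric] \<phi>_def[symmetric])
  qed simp
  ultimately show ?thesis
    using meas[OF im(1)] \<phi>bij by (simp add: measure_preserving_bijections_def \<phi>_def)
qed

lemma step_graphon_kernel: "step_graphon H \<in> kernels"
proof -
  have "step_graphon H \<in> borel_measurable unit_square"
    unfolding step_graphon_def Let_def case_prod_unfold by measurable
  then show ?thesis
    by (auto simp: kernels_def step_graphon_def Let_def intro!: exI[of _ 1])
qed

text \<open>
  An integer \<open>t\<close> satisfies \<open>c < t / n\<close> iff it exceeds the block number of \<open>c\<close>; this makes the half-open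
  intervals of separation compatible with rounding down to blocks.
\<close>
lemma separates_block_iff:
  assumes "0 < n" "0 \<le> x" "0 \<le> y"
  shows "separates (real t / n) x y \<longleftrightarrow> separates t (block n x) (block n y)"
proof -
  have less: "c < real t / n \<longleftrightarrow> block n c < t" if "0 \<le> c" for c
  proof -
    have "block n c < t \<longleftrightarrow> \<lfloor>real n * c\<rfloor> < int t" using that by (auto simp: block_def nat_less_iff)
    also have "\<dots> \<longleftrightarrow> n * c < t" by (simp add: floor_less_iff)
    finally show ?thesis using assms(1) by (simp add: field_simps)
  qed
  then show ?thesis using assms by (simp add: separates_def not_less[symmetric])
qed

text \<open>
  Moving the block of each vertex to its rank turns the step graphon into the cographon of the
  normalised ranks.
\<close>
lemma cut_distance_step_graphon_le:
  assumes n: "0 < n" and H: "card (pverts H) = n"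
    and bij: "bij_betw \<sigma> {..<n} {..<n}"
    and adj: "\<And>i j. i < n \<Longrightarrow> j < n \<Longrightarrow> (i, j) \<in> parcs H \<longleftrightarrow> first_label \<sigma> b (\<sigma> i) (\<sigma> j)"
    and W: "W \<in> kernels"
  shows "cut_distance (step_graphon H) W
    \<le> (\<integral>z. \<bar>cographon (\<lambda>m. real (\<sigma> m) / n) b z - W z\<bar> \<partial>unit_square)"
proof -
  define C where "C = cographon (\<lambda>m. real (\<sigma> m) / n) b"
  define \<phi> where "\<phi> = permute_blocks n \<sigma>"
  have \<phi>: "\<phi> \<in> measure_preserving_bijections" unfolding \<phi>_def by (rule permute_blocks_measure_preserving[OF n bij])
  have im: "\<sigma> ` {..<n} \<subseteq> {..<n}" using bij by (auto simp: bij_betw_def)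
  have CW: "(\<lambda>z. C z - W z) \<in> kernels"
    using graphons_subset_kernels cographon_graphon W by (auto simp: C_def intro!: kernels_diff)
  \<comment> \<open>On the lines \<open>x = 1\<close> and \<open>y = 1\<close> the step graphon has the block number \<open>n\<close>, which is no vertex.\<close>
  have eq: "step_graphon H (x, y) = relabel \<phi> C (x, y)" if "0 \<le> x" "x < 1" "0 \<le> y" "y < 1" for x y
  proof -
    note px = permute_blocks[OF n im that(1,2)] and py = permute_blocks[OF n im that(3,4)]
    have "relabel \<phi> C (x, y) = of_bool (first_label \<sigma> b (\<sigma> (block n x)) (\<sigma> (block n y)))"
      unfolding relabel_def C_def cographon_def first_label_def
      using px py by (simp add: separates_block_iff[OF n] \<phi>_def)
    also have "\<dots> = of_bool ((block n x, block n y) \<in> parcs H)"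
      using adj block_less[OF n] that by simp
    finally show ?thesis by (simp add: step_graphon_def H block_def)
  qed
  have "AE z in unit_square. fst z \<notin> {1} \<and> snd z \<notin> {1}"
    by (rule AE_unit_square_avoids_countable) simp
  then have ae: "AE z in unit_square.
      \<bar>step_graphon H z - relabel \<phi> W z\<bar> = relabel \<phi> (\<lambda>z. \<bar>C z - W z\<bar>) z"
    by (rule AE_mp[OF _ AE_I2]) (auto simp: eq, auto simp: relabel_def)
  have k: "(\<lambda>z. step_graphon H z - relabel \<phi> W z) \<in> kernels"
    by (intro kernels_diff step_graphon_kernel relabel_kernels \<phi> W)
  have abs: "(\<lambda>z. \<bar>C z - W z\<bar>) \<in> kernels" using CW by (auto simp: kernels_def)
  have "cut_distance (step_graphon H) W \<le> cut_norm (\<lambda>z. step_graphon H z - relabel \<phi> W z)"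
    by (intro cut_distance_le step_graphon_kernel W \<phi>)
  also have "\<dots> \<le> (\<integral>z. \<bar>step_graphon H z - relabel \<phi> W z\<bar> \<partial>unit_square)"
    by (rule cut_norm_le_L1[OF k])
  also have "\<dots> = (\<integral>z. relabel \<phi> (\<lambda>z. \<bar>C z - W z\<bar>) z \<partial>unit_square)"
    using k relabel_kernels[OF \<phi> abs] ae by (intro integral_cong_AE) (auto simp: kernels_def)
  also have "\<dots> = (\<integral>z. \<bar>C z - W z\<bar> \<partial>unit_square)"
    using abs by (intro integral_relabel \<phi>) (simp add: kernels_def)
  finally show ?thesis by (simp add: C_def)
qed

section \<open>Planar ranks of the vertices\<close>

text \<open>
  Here \<open>v j\<close> is the parent of vertex \<open>j\<close>, and \<open>twin_rank v n\<close> numbers the vertices \<open>0, \<dots>, n\<close> from left to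
  right, starting from 0. So it belongs to the graph with \<open>n + 1\<close> vertices. Vertices that are still
  absent get the value 0, the rank of vertex 0 at all times, and 0 never separates two ranks.
\<close>
primrec twin_rank :: "(nat \<Rightarrow> nat) \<Rightarrow> nat \<Rightarrow> nat \<Rightarrow> nat" where
  "twin_rank v 0 = (\<lambda>_. 0)"
| "twin_rank v (Suc n) = (\<lambda>i. if i = Suc n then twin_rank v n (v (Suc n)) + 1
     else twin_rank v n i + of_bool (twin_rank v n (v (Suc n)) < twin_rank v n i))"

lemma twin_rank_cong: "(\<And>j. 1 \<le> j \<Longrightarrow> j \<le> n \<Longrightarrow> v j = w j) \<Longrightarrow> twin_rank v n = twin_rank w n"
  by (induction n) auto

lemma twin_rank_Suc_less_iff:
  "i \<le> n \<Longrightarrow> j \<le> n \<Longrightarrow> twin_rank v (Suc n) i < twin_rank v (Suc n) j \<longleftrightarrow> twin_rank v n i < twin_rank v n j"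
  by auto

lemma twin_rank_Suc_new_less_iff:
  "j \<le> n \<Longrightarrow> twin_rank v (Suc n) (Suc n) < twin_rank v (Suc n) j \<longleftrightarrow> twin_rank v n (v (Suc n)) < twin_rank v n j"
  "j \<le> n \<Longrightarrow> twin_rank v (Suc n) j < twin_rank v (Suc n) (Suc n) \<longleftrightarrow> twin_rank v n j \<le> twin_rank v n (v (Suc n))"
  by auto

lemma twin_rank_le: "twin_rank v n i \<le> n"
  by (induction n arbitrary: i) (auto simp: of_bool_def intro: le_SucI)

lemma bij_betw_twin_rank:
  assumes "\<And>j. 1 \<le> j \<Longrightarrow> j \<le> n \<Longrightarrow> v j < j"
  shows "bij_betw (twin_rank v n) {..n} {..n}"
proof -
  have "inj_on (twin_rank v n) {..n}" using assms
  proof (induction n)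
    case (Suc n)
    have IH: "inj_on (twin_rank v n) {..n}" using Suc by auto
    have v: "v (Suc n) \<le> n" using Suc.prems[of "Suc n"] by simp
    have neq: "twin_rank v n i \<noteq> twin_rank v n j" if "i \<le> n" "j \<le> n" "i \<noteq> j" for i j
      using IH that by (auto dest: inj_onD)
    have "twin_rank v (Suc n) i < twin_rank v (Suc n) j \<or> twin_rank v (Suc n) j < twin_rank v (Suc n) i"
      if ij: "i \<le> Suc n" "j \<le> Suc n" "i \<noteq> j" for i j
    proof (cases "i \<le> n \<and> j \<le> n")
      case True
      with neq[of i j] that show ?thesis
        unfolding twin_rank_Suc_less_iff[OF conjunct1[OF True] conjunct2[OF True]]
          twin_rank_Suc_less_iff[OF conjunct2[OF True] conjunct1[OF True]] by linarith
    next
      case False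
      then consider "i = Suc n" "j \<le> n" | "j = Suc n" "i \<le> n" using ij by linarith
      then show ?thesis
        by cases (use twin_rank_Suc_new_less_iff[of _ n v] in \<open>metis not_less\<close>)+
    qed
    then show ?case by (intro inj_onI) (metis atMost_iff nat_neq_iff)
  qed simp
  moreover have "twin_rank v n ` {..n} \<subseteq> {..n}" by (auto simp: twin_rank_le)
  ultimately show ?thesis by (simp add: bij_betw_def endo_inj_surj)
qed

lemma separates_cong:
  assumes "x < t \<longleftrightarrow> x' < t'" "y < t \<longleftrightarrow> y' < t'"
  shows "separates t x y \<longleftrightarrow> separates t' x' y'"
  using assms by (simp add: separates_def not_less[symmetric])

text \<open>
  Only indices up to \<open>N\<close> need to be compared once some index up to \<open>N\<close> separates the two points.
\<close>
lemma first_label_cong: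
  assumes "\<And>m. separates (u m) x y \<Longrightarrow> \<exists>l\<le>N. separates (u l) x y"
    and "\<And>m. separates (w m) x' y' \<Longrightarrow> \<exists>l\<le>N. separates (w l) x' y'"
    and "\<And>m. m \<le> N \<Longrightarrow> separates (u m) x y \<longleftrightarrow> separates (w m) x' y'"
  shows "first_label u b x y \<longleftrightarrow> first_label w b x' y'"
proof -
  have "(separates (u m) x y \<and> (\<forall>l<m. \<not> separates (u l) x y)) \<longleftrightarrow>
      (separates (w m) x' y' \<and> (\<forall>l<m. \<not> separates (w l) x' y'))" for m
    using assms by (metis le_trans less_imp_le linorder_not_le)
  then show ?thesis by (simp add: first_label_def)
qed

text \<open>
  The insertion of vertex \<open>n + 1\<close> comes too late to be the first to separate two old vertices, as
  the one with the larger rank already separates them.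
\<close>
lemma first_label_twin_rank_old:
  assumes "i \<le> n" "j \<le> n"
  shows "first_label (twin_rank v (Suc n)) b (twin_rank v (Suc n) i) (twin_rank v (Suc n) j)
    \<longleftrightarrow> first_label (twin_rank v n) b (twin_rank v n i) (twin_rank v n j)"
proof (rule first_label_cong[where N = n])
  show "separates (twin_rank v (Suc n) m) (twin_rank v (Suc n) i) (twin_rank v (Suc n) j)
    \<longleftrightarrow> separates (twin_rank v n m) (twin_rank v n i) (twin_rank v n j)" if "m \<le> n" for m
    using that assms by (intro separates_cong twin_rank_Suc_less_iff)
  show "\<exists>l\<le>n. separates (twin_rank v (Suc n) l) (twin_rank v (Suc n) i) (twin_rank v (Suc n) j)"
    if "separates (twin_rank v (Suc n) m) (twin_rank v (Suc n) i) (twin_rank v (Suc n) j)" for m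
  proof -
    \<comment> \<open>Two distinct ranks are always separated by the larger of the two.\<close>
    have "twin_rank v (Suc n) i \<noteq> twin_rank v (Suc n) j" using that by auto
    then show ?thesis using assms by (metis linorder_neqE_nat order_refl separates_def)
  qed
  show "\<exists>l\<le>n. separates (twin_rank v n l) (twin_rank v n i) (twin_rank v n j)"
    if "separates (twin_rank v n m) (twin_rank v n i) (twin_rank v n j)" for m
  proof -
    have "twin_rank v n i \<noteq> twin_rank v n j" using that by auto
    then show ?thesis using assms by (metis linorder_neqE_nat order_refl separates_def)
  qed
qed

text \<open>
  No old vertex lies between the parent and its new twin, so any other old vertex is first separated
  from both by the same vertex.
\<close>
lemma first_label_twin_rank_new:
  assumes "v (Suc n) \<le> n" "j \<le> n" "twin_rank v n j \<noteq> twin_rank v n (v (Suc n))"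
  shows "first_label (twin_rank v (Suc n)) b (twin_rank v (Suc n) (Suc n)) (twin_rank v (Suc n) j)
    \<longleftrightarrow> first_label (twin_rank v n) b (twin_rank v n (v (Suc n))) (twin_rank v n j)"
proof (rule first_label_cong[where N = n])
  show "separates (twin_rank v (Suc n) m) (twin_rank v (Suc n) (Suc n)) (twin_rank v (Suc n) j)
    \<longleftrightarrow> separates (twin_rank v n m) (twin_rank v n (v (Suc n))) (twin_rank v n j)" if "m \<le> n" for m
    using that assms by (intro separates_cong twin_rank_Suc_less_iff twin_rank_Suc_new_less_iff)
  have old: "\<exists>l\<le>n. separates (twin_rank v n l) (twin_rank v n (v (Suc n))) (twin_rank v n j)"
    using assms by (metis linorder_neqE_nat order_refl separates_def)
  then show "\<exists>l\<le>n. separates (twin_rank v n l) (twin_rank v n (v (Suc n))) (twin_rank v n j)" .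
  from old obtain l where l: "l \<le> n" "separates (twin_rank v n l) (twin_rank v n (v (Suc n))) (twin_rank v n j)"
    by blast
  have "separates (twin_rank v (Suc n) l) (twin_rank v (Suc n) (Suc n)) (twin_rank v (Suc n) j)
    \<longleftrightarrow> separates (twin_rank v n l) (twin_rank v n (v (Suc n))) (twin_rank v n j)"
    using l(1) assms by (intro separates_cong twin_rank_Suc_less_iff twin_rank_Suc_new_less_iff)
  then show "\<exists>l\<le>n. separates (twin_rank v (Suc n) l) (twin_rank v (Suc n) (Suc n)) (twin_rank v (Suc n) j)"
    using l by blast
qed

text \<open>
  The new vertex is adjacent in rank to its parent, so it is the only one that separates the two.
\<close>
lemma first_label_twin_rank_twin:
  assumes "v (Suc n) \<le> n"
    and inj: "\<And>j. j \<le> n \<Longrightarrow> twin_rank v n j = twin_rank v n (v (Suc n)) \<Longrightarrow> j = v (Suc n)"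
  shows "first_label (twin_rank v (Suc n)) b (twin_rank v (Suc n) (Suc n)) (twin_rank v (Suc n) (v (Suc n))) \<longleftrightarrow> b (Suc n)"
proof (rule first_label_iff)
  show "separates (twin_rank v (Suc n) (Suc n)) (twin_rank v (Suc n) (Suc n)) (twin_rank v (Suc n) (v (Suc n)))"
    using assms by (simp add: separates_def)
  show "\<not> separates (twin_rank v (Suc n) l) (twin_rank v (Suc n) (Suc n)) (twin_rank v (Suc n) (v (Suc n)))"
    if "l < Suc n" for l
    using that assms by (auto simp: separates_def)
qed

text \<open>
  A new vertex inherits the neighbours of its parent, and by \<open>first_label_twin_rank_new\<close> it also inherits
  the first labels; towards the parent itself the label is that of the new insertion.
\<close>
lemma grown_graph:
  assumes init: "G 1 = \<lparr>pverts = {0}, parcs = {}\<rparr>"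
    and step: "\<And>n. 1 \<le> n \<Longrightarrow> G (n + 1) = add_twin (v n) n (b n) (G n)"
    and v: "\<And>n. 1 \<le> n \<Longrightarrow> v n < n"
  shows "pverts (G (Suc n)) = {..n} \<and> parcs (G (Suc n)) \<subseteq> {..n} \<times> {..n} \<and>
    (\<forall>i\<le>n. \<forall>j\<le>n. (i, j) \<in> parcs (G (Suc n)) \<longleftrightarrow>
      first_label (twin_rank v n) b (twin_rank v n i) (twin_rank v n j))"
proof (induction n)
  case 0
  then show ?case using init by (auto simp: first_label_def)
next
  case (Suc n)
  have G: "G (Suc (Suc n)) = add_twin (v (Suc n)) (Suc n) (b (Suc n)) (G (Suc n))"
    using step[of "Suc n"] by simp
  have verts: "pverts (G (Suc n)) = {..n}" and arcs: "parcs (G (Suc n)) \<subseteq> {..n} \<times> {..n}"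
    and IH: "\<And>i j. i \<le> n \<Longrightarrow> j \<le> n \<Longrightarrow> (i, j) \<in> parcs (G (Suc n)) \<longleftrightarrow>
      first_label (twin_rank v n) b (twin_rank v n i) (twin_rank v n j)"
    using Suc.IH by auto
  define a where "a = v (Suc n)"
  have a: "a \<le> n" using v[of "Suc n"] by (simp add: a_def)
  have "inj_on (twin_rank v n) {..n}" using bij_betw_twin_rank[of n v] v by (auto simp: bij_betw_def)
  then have inj: "i = j" if "twin_rank v n i = twin_rank v n j" "i \<le> n" "j \<le> n" for i j
    using that by (auto dest: inj_onD)
  have arcs': "(i, j) \<in> parcs (G (Suc (Suc n))) \<longleftrightarrow> (i, j) \<in> parcs (G (Suc n))
      \<or> i = Suc n \<and> (a, j) \<in> parcs (G (Suc n)) \<or> j = Suc n \<and> (i, a) \<in> parcs (G (Suc n))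
      \<or> b (Suc n) \<and> (i = a \<and> j = Suc n \<or> i = Suc n \<and> j = a)" for i j
    by (auto simp: G add_twin_def a_def)
  have no_loop: "(a, a) \<notin> parcs (G (Suc n))"
    using IH[OF a a] by (simp add: first_label_def)
  have new: "first_label (twin_rank v (Suc n)) b (twin_rank v (Suc n) (Suc n)) (twin_rank v (Suc n) j) \<longleftrightarrow>
      (a, j) \<in> parcs (G (Suc n)) \<or> b (Suc n) \<and> j = a" if "j \<le> n" for j
  proof (cases "j = a")
    case True
    then show ?thesis using first_label_twin_rank_twin[of v n b] a inj no_loop unfolding a_def by blast
  next
    case False
    then have "twin_rank v n j \<noteq> twin_rank v n a" using inj[of j a] a that by blast
    then show ?thesis
      using first_label_twin_rank_new[of v n j b] IH[OF a that] False a that unfolding a_def by blast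
  qed
  have "(i, j) \<in> parcs (G (Suc (Suc n))) \<longleftrightarrow>
      first_label (twin_rank v (Suc n)) b (twin_rank v (Suc n) i) (twin_rank v (Suc n) j)"
    if "i \<le> Suc n" "j \<le> Suc n" for i j
  proof -
    have out: "(k, Suc n) \<notin> parcs (G (Suc n))" "(Suc n, k) \<notin> parcs (G (Suc n))" for k
      using arcs by auto
    have sym: "(i, a) \<in> parcs (G (Suc n)) \<longleftrightarrow> (a, i) \<in> parcs (G (Suc n))" if "i \<le> n" for i
      using IH[OF that a] IH[OF a that] first_label_sym by blast
    consider "i \<le> n" "j \<le> n" | "i = Suc n" "j \<le> n" | "i \<le> n" "j = Suc n" | "i = Suc n" "j = Suc n"
      using \<open>i \<le> Suc n\<close> \<open>j \<le> Suc n\<close> by linarith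
    then show ?thesis
    proof cases
      case 1
      then show ?thesis unfolding first_label_twin_rank_old[OF 1] using IH[OF 1] by (simp add: arcs')
    next
      case 2
      then show ?thesis using new[OF 2(2)] out a by (auto simp: arcs' simp del: twin_rank.simps)
    next
      case 3
      then show ?thesis
        using new[OF 3(1)] out a sym[OF 3(1)] first_label_sym[of "twin_rank v (Suc n)" b]
        by (auto simp: arcs' simp del: twin_rank.simps)
    next
      case 4
      have "\<not> first_label (twin_rank v (Suc n)) b (twin_rank v (Suc n) i) (twin_rank v (Suc n) j)"
        unfolding 4 first_label_def by simp
      then show ?thesis using 4 out a by (auto simp: arcs' simp del: twin_rank.simps)
    qed
  qed
  moreover have "pverts (G (Suc (Suc n))) = {..Suc n}"
    by (auto simp: G add_twin_def verts)
  moreover have "parcs (G (Suc (Suc n))) \<subseteq> {..Suc n} \<times> {..Suc n}"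
  proof (rule subrelI)
    fix i j assume "(i, j) \<in> parcs (G (Suc (Suc n)))"
    then have "i \<le> Suc n \<and> j \<le> Suc n" unfolding arcs' using arcs a by auto
    then show "(i, j) \<in> {..Suc n} \<times> {..Suc n}" by simp
  qed
  ultimately show ?case by blast
qed

section \<open>Real sequences and urn estimates\<close>

text \<open>
  By the inequality of arithmetic and geometric means, \<open>\<bar>D\<bar> \<le> 1 / t\<^sup>2 + t\<^sup>2 D\<^sup>2\<close>, so the second
  moments along the cubes control the absolute increments there. Cubes are a compromise: sparse enough
  for the sum with weights \<open>t\<^sup>2\<close> to converge when squared increments are like
  \<open>1 / t\<^sup>3 - 1 / (t + 1)\<^sup>3\<close>, yet with
  ratios of consecutive terms tending to 1, so that the drift in between is negligible.
\<close>
lemma slowly_varying_convergent: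
  fixes X :: "nat \<Rightarrow> real"
  assumes k: "1 \<le> k"
    and incr: "\<And>n. k \<le> n \<Longrightarrow> \<bar>X (Suc n) - X n\<bar> \<le> 1 / (real n + 2)"
    and summ: "summable (\<lambda>s. real (s + k) ^ 2 * (X ((Suc s + k) ^ 3) - X ((s + k) ^ 3)) ^ 2)"
  shows "convergent X"
proof -
  define Y where "Y s = X ((s + k) ^ 3)" for s
  have "summable (\<lambda>s. inverse (real (s + k) ^ 2) + real (s + k) ^ 2 * (Y (Suc s) - Y s) ^ 2)"
    using summ inverse_power_summable[of 2, where 'a = real, THEN summable_ignore_initial_segment, of k]
    by (intro summable_add) (simp_all add: Y_def)
  moreover have "norm (Y (Suc s) - Y s) \<le>
      inverse (real (s + k) ^ 2) + real (s + k) ^ 2 * (Y (Suc s) - Y s) ^ 2" for s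
  proof -
    define t where "t = real (s + k)"
    define D where "D = \<bar>Y (Suc s) - Y s\<bar>"
    have t: "t > 0" using k by (simp add: t_def)
    have "0 \<le> (inverse t - t * D) ^ 2 + D" by (simp add: D_def)
    also have "\<dots> = inverse (t ^ 2) + t ^ 2 * D ^ 2 - D"
      using t by (simp add: power2_diff power_mult_distrib power_inverse)
    finally show ?thesis by (simp add: D_def t_def)
  qed
  ultimately have "summable (\<lambda>s. Y (Suc s) - Y s)" by (rule summable_comparison_test'[where N = 0])
  then have "convergent (\<lambda>n. \<Sum>s<n. Y (Suc s) - Y s)" by (simp add: summable_iff_convergent)
  then have "convergent (\<lambda>n. (Y n - Y 0) + Y 0)"
    unfolding sum_lessThan_telescope by (intro convergent_add convergent_const)
  then obtain L where L: "Y \<longlonglongrightarrow> L" by (auto simp: convergent_def)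
  have drift: "\<bar>X (n + d) - X n\<bar> \<le> real d / n" if "k \<le> n" for n d
  proof (induction d)
    case (Suc d)
    have "\<bar>X (n + Suc d) - X n\<bar> \<le> \<bar>X (Suc (n + d)) - X (n + d)\<bar> + \<bar>X (n + d) - X n\<bar>" by simp
    also have "\<bar>X (Suc (n + d)) - X (n + d)\<bar> \<le> 1 / (real (n + d) + 2)" using that by (intro incr) simp
    also have "\<dots> \<le> 1 / n" using that k by (intro divide_left_mono) auto
    finally show ?case using Suc by (simp add: add_divide_distrib)
  qed simp
  have "X \<longlonglongrightarrow> L"
  proof (rule metric_LIMSEQ_I)
    fix e :: real assume "0 < e"
    then obtain s0 where s0: "\<And>s. s \<ge> s0 \<Longrightarrow> dist (Y s) L < e / 2"
      using metric_LIMSEQ_D[OF L, of "e / 2"] by auto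
    obtain s1 :: nat where "14 / e < s1" using reals_Archimedean2 by blast
    define s2 where "s2 = max s0 s1"
    have "dist (X n) L < e" if n: "n \<ge> (s2 + k) ^ 3" for n
    proof -
      define P where "P s \<longleftrightarrow> s2 \<le> s \<and> (s + k) ^ 3 \<le> n" for s
      have P: "P s2" using n by (simp add: P_def)
      have bound: "\<forall>s. P s \<longrightarrow> s \<le> n"
      proof (intro allI impI)
        fix s assume "P s"
        then have "(s + k) ^ 3 \<le> n" by (simp add: P_def)
        moreover have "s + k \<le> (s + k) ^ 3" by (rule self_le_power) (use k in auto)
        ultimately show "s \<le> n" by linarith
      qed
      \<comment> \<open>The last cube not exceeding \<open>n\<close> has the base \<open>s + k\<close>.\<close>
      define s where "s = Greatest P"
      have s: "P s" unfolding s_def using P bound by (metis GreatestI_nat)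
      have "\<not> P (Suc s)" unfolding s_def using bound by (metis Greatest_le_nat Suc_n_not_le_n)
      with s have lt: "n < (Suc s + k) ^ 3" "(s + k) ^ 3 \<le> n" "s2 \<le> s" by (auto simp: P_def)
      define t where "t = s + k"
      have t: "1 \<le> t" using k by (simp add: t_def)
      have "k \<le> t ^ 3" using self_le_power[of t 3] t by (simp add: t_def)
      then have "\<bar>X n - X (t ^ 3)\<bar> \<le> real (n - t ^ 3) / (t ^ 3)"
        using drift[of "t ^ 3" "n - t ^ 3"] lt(2) by (simp add: t_def)
      also have "\<dots> \<le> real (7 * t ^ 2) / (t ^ 3)"
      proof -
        have "n < t ^ 3 + 3 * t ^ 2 + 3 * t + 1"
          using lt(1) by (simp add: t_def power3_eq_cube power2_eq_square algebra_simps)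
        moreover have "t \<le> t ^ 2" "1 \<le> t ^ 2" using t by (auto simp: power2_eq_square)
        ultimately have "n - t ^ 3 \<le> 7 * t ^ 2" by linarith
        then have "real (n - t ^ 3) \<le> real (7 * t ^ 2)" by (rule of_nat_mono)
        then show ?thesis by (rule divide_right_mono) simp
      qed
      also have "\<dots> = 7 / t" using t by (simp add: power3_eq_cube power2_eq_square)
      also have "\<dots> < e / 2"
      proof -
        have "14 / e < t" using \<open>14 / e < s1\<close> lt(3) by (simp add: t_def s2_def)
        then show ?thesis using \<open>0 < e\<close> t by (simp add: field_simps)
      qed
      finally have "dist (X n) (Y s) < e / 2" by (simp add: dist_real_def Y_def t_def)
      moreover have "dist (Y s) L < e / 2" using lt(3) by (intro s0) (simp add: s2_def)
      ultimately show ?thesis using dist_triangle[of "X n" L "Y s"] by linarith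
    qed
    then show "\<exists>N. \<forall>n\<ge>N. dist (X n) L < e" by blast
  qed
  then show ?thesis by (rule convergentI)
qed

text \<open>
  If \<open>(a, b)\<close> contained no limit point, every vertex with normalised rank in the middle half of \<open>(a, b)\<close>
  would be at distance at least \<open>(b - a) / 4\<close> from its limit. As the ranks exhaust
  \<open>0, \<dots>, n\<close>, there are arbitrarily many such vertices.
\<close>
lemma dense_of_bounded_displacement:
  fixes U :: "nat \<Rightarrow> real"
  assumes bij: "\<And>n. bij_betw (\<sigma> n) {..n} {..n}"
    and freq: "\<exists>\<^sub>F n in sequentially. (\<Sum>i\<le>n. (U i - real (\<sigma> n i) / (real n + 1)) ^ 2) < K"
    and ab: "0 \<le> a" "a < b" "b \<le> 1"
  shows "\<exists>i. a < U i \<and> U i < b"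
proof (rule ccontr)
  assume "\<not> ?thesis"
  then have gap: "U i \<le> a \<or> b \<le> U i" for i by (meson not_less)
  define d where "d = (b - a) / 4"
  have d: "0 < d" "b - d = a + d + 2 * d" using ab by (simp_all add: d_def field_simps)
  obtain Q :: nat where Q: "K / d ^ 2 < Q" using reals_Archimedean2 by blast
  obtain N :: nat where N: "(real Q + 1) / (2 * d) < N" using reals_Archimedean2 by blast
  from freq obtain n where n: "n \<ge> N"
    and sum: "(\<Sum>i\<le>n. (U i - real (\<sigma> n i) / (real n + 1)) ^ 2) < K"
    unfolding frequently_sequentially by blast
  define c where "c = nat \<lceil>(a + d) * (real n + 1)\<rceil>"
  have c: "(a + d) * (real n + 1) \<le> c" "c < (a + d) * (real n + 1) + 1"
  proof -
    have "0 \<le> (a + d) * (real n + 1)" using ab d by simp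
    then have "real c = of_int \<lceil>(a + d) * (real n + 1)\<rceil>" by (simp add: c_def)
    then show "(a + d) * (real n + 1) \<le> c" "c < (a + d) * (real n + 1) + 1"
      using ceiling_correct[of "(a + d) * (real n + 1)"] by linarith+
  qed
  have "(real Q + 1) / (2 * d) < real n + 1" using N n by linarith
  then have Qn: "real Q + 1 < 2 * d * (real n + 1)" using d by (simp add: field_simps)
  have r: "a + d \<le> real r / (real n + 1)" "real r / (real n + 1) < b - d" if "r \<in> {c..<c + Q}" for r
  proof -
    have "(a + d) * (real n + 1) \<le> r" using c that by simp
    then show "a + d \<le> real r / (real n + 1)" by (simp add: field_simps)
    have "real r < c + Q" using that by simp
    also have "\<dots> < (a + d) * (real n + 1) + 2 * d * (real n + 1)" using c(2) Qn by linarith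
    also have "\<dots> = (b - d) * (real n + 1)" unfolding d(2) by (simp add: algebra_simps)
    finally show "real r / (real n + 1) < b - d" by (simp add: field_simps)
  qed
  have sub: "{c..<c + Q} \<subseteq> {..n}"
  proof
    fix r assume "r \<in> {c..<c + Q}"
    then have "real r / (real n + 1) < 1" using r(2)[of r] ab d by linarith
    then have "real r < real n + 1" by (simp add: divide_less_eq)
    then show "r \<in> {..n}" by simp
  qed
  define \<tau> where "\<tau> = the_inv_into {..n} (\<sigma> n)"
  have \<tau>: "\<tau> (\<sigma> n i) = i" if "i \<le> n" for i
    unfolding \<tau>_def using bij[of n] that by (simp add: bij_betw_def the_inv_into_f_f)
  have "Q * d ^ 2 = (\<Sum>r\<in>{c..<c + Q}. d ^ 2)" by simp
  also have "\<dots> \<le> (\<Sum>r\<in>{c..<c + Q}. (U (\<tau> r) - real r / (real n + 1)) ^ 2)"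
  proof (rule sum_mono)
    fix r assume "r \<in> {c..<c + Q}"
    then have "d \<le> \<bar>U (\<tau> r) - real r / (real n + 1)\<bar>"
      using r[of r] gap[of "\<tau> r"] by linarith
    then show "d ^ 2 \<le> (U (\<tau> r) - real r / (real n + 1)) ^ 2"
      using d by (metis abs_le_square_iff abs_of_pos)
  qed
  also have "\<dots> \<le> (\<Sum>r\<le>n. (U (\<tau> r) - real r / (real n + 1)) ^ 2)"
    using sub by (intro sum_mono2) auto
  also have "\<dots> = (\<Sum>i\<le>n. (U (\<tau> (\<sigma> n i)) - real (\<sigma> n i) / (real n + 1)) ^ 2)"
    by (rule sum.reindex_bij_betw[OF bij, symmetric])
  also have "\<dots> = (\<Sum>i\<le>n. (U i - real (\<sigma> n i) / (real n + 1)) ^ 2)"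
    by (intro sum.cong) (auto simp: \<tau>)
  also have "\<dots> < K" by (rule sum)
  finally have "Q * d ^ 2 < K" .
  moreover have "K < Q * d ^ 2" using Q d by (simp add: field_simps)
  ultimately show False by simp
qed

text \<open>
  One step of the urn: \<open>r\<close> of the \<open>m + 1\<close> equally likely parents raise the rank \<open>r\<close> by one. The mean of the
  new normalised rank is the old one, and its variance is \<open>\<theta> (1 - \<theta>) / (m + 2)\<^sup>2\<close> with
  \<open>\<theta> = r / (m + 1)\<close>.
\<close>
lemma urn_second_moment:
  fixes c :: real
  assumes bij: "bij_betw \<sigma> {..m} {..m}" and r: "r \<le> m"
  shows "(\<Sum>a\<le>m. ((real r + of_bool (\<sigma> a < r)) / (real m + 2) - c) ^ 2)
    \<le> (real m + 1) * ((real r / (real m + 1) - c) ^ 2 + 1 / (real m + 2) ^ 2)"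
proof -
  define N where "N = real m + 1"
  have N: "0 < N" "real r \<le> N" using r by (auto simp: N_def)
  define f where "f a = ((real r + of_bool (a < r)) / (N + 1) - c) ^ 2" for a
  have "(\<Sum>a\<le>m. f (\<sigma> a)) = (\<Sum>a\<le>m. f a)" by (rule sum.reindex_bij_betw[OF bij])
  also have "(\<Sum>a\<le>m. f a) = sum f ({..<r} \<union> {r..m})"
    using r by (intro arg_cong[where f = "sum f"]) auto
  also have "sum f ({..<r} \<union> {r..m}) = sum f {..<r} + sum f {r..m}" by (rule sum.union_disjoint) auto
  also have "sum f {..<r} = r * ((real r + 1) / (N + 1) - c) ^ 2" by (simp add: f_def)
  also have "sum f {r..m} = (N - r) * (real r / (N + 1) - c) ^ 2"
    using r by (simp add: f_def N_def)
  also have "r * ((real r + 1) / (N + 1) - c) ^ 2 + (N - r) * (real r / (N + 1) - c) ^ 2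
      = N * (real r / N - c) ^ 2 + r * (N - r) / (N * (N + 1) ^ 2)"
  proof -
    define x where "x = real r"
    have "N \<noteq> 0" "N + 1 \<noteq> 0" using N by auto
    then show ?thesis unfolding x_def[symmetric] power2_eq_square
      by (simp add: divide_simps) algebra
  qed
  also have "r * (N - r) / (N * (N + 1) ^ 2) \<le> N * (1 / (N + 1) ^ 2)"
  proof -
    have "r * (N - r) \<le> N * N" using N by (intro mult_mono) auto
    then have "r * (N - r) / (N * (N + 1) ^ 2) \<le> N * N / (N * (N + 1) ^ 2)"
      using N by (intro divide_right_mono) auto
    then show ?thesis using N by simp
  qed
  finally show ?thesis by (simp add: f_def N_def distrib_left add.commute)
qed

lemma twin_rank_increment:
  assumes "i \<le> n"
  shows "\<bar>real (twin_rank v (Suc n) i) / (real n + 2) - real (twin_rank v n i) / (real n + 1)\<bar> \<le> 1 / (real n + 2)"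
proof -
  define r where "r = real (twin_rank v n i)"
  define \<xi> where "\<xi> = (of_bool (twin_rank v n (v (Suc n)) < twin_rank v n i) :: real)"
  have r: "0 \<le> r" "r \<le> n" using twin_rank_le[of v n i] by (auto simp: r_def)
  have "real (twin_rank v (Suc n) i) = r + \<xi>" using assms by (simp add: r_def \<xi>_def)
  then have "real (twin_rank v (Suc n) i) / (real n + 2) - r / (real n + 1)
      = (\<xi> - r / (real n + 1)) / (real n + 2)"
    by (simp add: field_simps)
  moreover have "0 \<le> r / (real n + 1)" "r / (real n + 1) \<le> 1" using r by (auto simp: field_simps)
  then have "\<bar>\<xi> - r / (real n + 1)\<bar> \<le> 1"
    unfolding \<xi>_def of_bool_def by (smt (verit))
  ultimately show ?thesis by (simp add: r_def divide_right_mono)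
qed

section \<open>Limits of the normalised ranks\<close>

text \<open>
  Only the choices of the parents enter the limits of the ranks; the labels are put aside until the
  graphs are assembled.
\<close>
locale uniform_parents = prob_space M for M :: "'a measure" +
  fixes V :: "nat \<Rightarrow> 'a \<Rightarrow> nat"
  assumes indep: "indep_vars (\<lambda>_. count_space UNIV) V {1..}"
    and uniform: "1 \<le> n \<Longrightarrow> distr M (count_space UNIV) (V n) = measure_pmf (pmf_of_set {..<n})"
begin

lemma V_measurable: "1 \<le> n \<Longrightarrow> V n \<in> M \<rightarrow>\<^sub>M count_space UNIV"
  using indep by (auto simp: indep_vars_def)

lemma prob_V:
  assumes "a \<le> n"
  shows "prob (V (Suc n) -` {a} \<inter> space M) = 1 / (real n + 1)"
proof -
  have "prob (V (Suc n) -` {a} \<inter> space M) = measure (distr M (count_space UNIV) (V (Suc n))) {a}"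
    using V_measurable[of "Suc n"] by (subst measure_distr) auto
  also have "\<dots> = pmf (pmf_of_set {..<Suc n}) a"
    by (subst uniform) (simp_all add: measure_pmf_single)
  also have "\<dots> = 1 / (real n + 1)"
    using assms by (subst pmf_of_set) (auto simp: lessThan_empty_iff add.commute)
  finally show ?thesis .
qed

lemma AE_V_less: "AE \<omega> in M. \<forall>n\<ge>1. V n \<omega> < n"
proof -
  have "AE \<omega> in M. V n \<omega> < n" if n: "1 \<le> n" for n
  proof -
    have "AE a in measure_pmf (pmf_of_set {..<n}). a < n"
      using n by (subst AE_measure_pmf_iff) (auto simp: set_pmf_of_set lessThan_empty_iff)
    then have "AE a in distr M (count_space UNIV) (V n). a < n" by (simp only: uniform[OF n])
    then show ?thesis by (subst (asm) AE_distr_iff) (use V_measurable[OF n] in auto)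
  qed
  then show ?thesis by (subst AE_all_countable) auto
qed

definition past :: "nat \<Rightarrow> 'a \<Rightarrow> nat \<Rightarrow> nat" where
  "past n \<omega> = (\<lambda>j\<in>{1..n}. V j \<omega>)"

lemma past_measurable: "past n \<in> M \<rightarrow>\<^sub>M count_space ({1..n} \<rightarrow>\<^sub>E UNIV)"
proof -
  have "past n \<in> M \<rightarrow>\<^sub>M PiM {1..n} (\<lambda>_. count_space UNIV)"
    unfolding past_def by (rule measurable_restrict) (simp add: V_measurable)
  then show ?thesis by (simp add: count_space_PiM_finite)
qed

lemma indep_past:
  fixes f :: "(nat \<Rightarrow> nat) \<Rightarrow> real" and g :: "nat \<Rightarrow> real"
  shows "indep_var borel (\<lambda>\<omega>. f (past n \<omega>)) borel (\<lambda>\<omega>. g (V (Suc n) \<omega>))"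
proof -
  have "indep_var (PiM {1..n} (\<lambda>_. count_space UNIV)) (past n)
      (PiM {Suc n} (\<lambda>_. count_space UNIV)) (\<lambda>\<omega>. \<lambda>j\<in>{Suc n}. V j \<omega>)"
    unfolding past_def using indep by (rule indep_var_restrict) auto
  moreover have "f \<in> PiM {1..n} (\<lambda>_. count_space UNIV) \<rightarrow>\<^sub>M borel"
    by (simp add: count_space_PiM_finite)
  moreover have "(\<lambda>w. g (w (Suc n))) \<in> PiM {Suc n} (\<lambda>_. count_space UNIV) \<rightarrow>\<^sub>M borel"
    by (simp add: count_space_PiM_finite)
  ultimately have "indep_var borel (f \<circ> past n)
      borel ((\<lambda>w. g (w (Suc n))) \<circ> (\<lambda>\<omega>. \<lambda>j\<in>{Suc n}. V j \<omega>))"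
    by (rule indep_var_compose)
  then show ?thesis by (simp add: comp_def)
qed

text \<open>
  The new parent is uniform and independent of the earlier ones, so conditioning on the past replaces
  it by an average over the vertices.
\<close>
lemma expectation_step:
  fixes F :: "(nat \<Rightarrow> nat) \<Rightarrow> nat \<Rightarrow> real"
  assumes bound: "\<And>w a. \<bar>F w a\<bar> \<le> C"
  shows "expectation (\<lambda>\<omega>. F (past n \<omega>) (V (Suc n) \<omega>))
      = expectation (\<lambda>\<omega>. (\<Sum>a\<le>n. F (past n \<omega>) a) / (real n + 1))"
proof -
  have V: "V (Suc n) \<in> M \<rightarrow>\<^sub>M count_space UNIV" by (rule V_measurable) simp
  have Fm [measurable]: "(\<lambda>\<omega>. F (past n \<omega>) a) \<in> borel_measurable M" for a
    by (rule measurable_compose[OF past_measurable]) simp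
  have Fi: "integrable M (\<lambda>\<omega>. F (past n \<omega>) a)" for a
    by (rule integrable_const_bound[where B = C]) (use bound in auto)
  have [measurable]: "(\<lambda>\<omega>. indicator {a} (V (Suc n) \<omega>) :: real) \<in> borel_measurable M" for a
    by (rule measurable_compose[OF V]) simp
  have Vi: "integrable M (\<lambda>\<omega>. indicator {a} (V (Suc n) \<omega>) :: real)" for a
    by (rule integrable_const_bound[where B = 1]) auto
  note ind = indep_past[of "\<lambda>w. F w a" n "indicator {a}" for a]
  have EV: "expectation (\<lambda>\<omega>. indicator {a} (V (Suc n) \<omega>)) = 1 / (real n + 1)" if "a \<le> n" for a
  proof -
    have "expectation (\<lambda>\<omega>. indicator {a} (V (Suc n) \<omega>)) = expectation (indicator (V (Suc n) -` {a} \<inter> space M))"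
      by (rule Bochner_Integration.integral_cong) (auto simp: indicator_def)
    also have "\<dots> = prob (V (Suc n) -` {a} \<inter> space M)" by simp
    finally show ?thesis using prob_V[OF that] by simp
  qed
  have "expectation (\<lambda>\<omega>. F (past n \<omega>) (V (Suc n) \<omega>))
      = expectation (\<lambda>\<omega>. \<Sum>a\<le>n. F (past n \<omega>) a * indicator {a} (V (Suc n) \<omega>))"
  proof (rule integral_cong_AE)
    show "(\<lambda>\<omega>. F (past n \<omega>) (V (Suc n) \<omega>)) \<in> borel_measurable M"
      by (rule measurable_compose_countable[OF Fm V])
    show "AE \<omega> in M. F (past n \<omega>) (V (Suc n) \<omega>) =
        (\<Sum>a\<le>n. F (past n \<omega>) a * indicator {a} (V (Suc n) \<omega>))"
      using AE_V_less
    proof eventually_elim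
      case (elim \<omega>)
      then have "V (Suc n) \<omega> \<le> n" by (metis le_add1 less_Suc_eq_le plus_1_eq_Suc)
      then show ?case by (simp add: indicator_def of_bool_def if_distrib cong: if_cong)
    qed
  qed measurable
  also have "\<dots> = (\<Sum>a\<le>n. expectation (\<lambda>\<omega>. F (past n \<omega>) a * indicator {a} (V (Suc n) \<omega>)))"
    by (rule Bochner_Integration.integral_sum) (rule indep_var_integrable[OF ind Fi Vi])
  also have "\<dots> = (\<Sum>a\<le>n. expectation (\<lambda>\<omega>. F (past n \<omega>) a) * (1 / (real n + 1)))"
    by (intro sum.cong refl) (simp add: indep_var_lebesgue_integral[OF ind Fi Vi] EV)
  also have "\<dots> = expectation (\<lambda>\<omega>. (\<Sum>a\<le>n. F (past n \<omega>) a) / (real n + 1))"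
    using Fi by (simp add: sum_divide_distrib)
  finally show ?thesis .
qed

definition position :: "nat \<Rightarrow> nat \<Rightarrow> 'a \<Rightarrow> real" where
  "position n i \<omega> = real (twin_rank (\<lambda>j. V j \<omega>) n i) / (real n + 1)"

lemma position_bounds: "0 \<le> position n i \<omega>" "position n i \<omega> \<le> 1"
  using twin_rank_le[of "\<lambda>j. V j \<omega>" n i] by (auto simp: position_def)

lemma position_diff_sq_le: "(position m i \<omega> - position n i \<omega>) ^ 2 \<le> 1"
  using position_bounds[of m i \<omega>] position_bounds[of n i \<omega>] by (auto simp: abs_square_le_1 abs_le_iff)

lemma twin_rank_past: "m \<le> n \<Longrightarrow> twin_rank (past n \<omega>) m = twin_rank (\<lambda>j. V j \<omega>) m"
  by (rule twin_rank_cong) (simp add: past_def)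

lemma position_measurable [measurable]: "position n i \<in> borel_measurable M"
proof -
  have "(\<lambda>\<omega>. real (twin_rank (past n \<omega>) n i)) \<in> borel_measurable M"
    by (rule measurable_compose[OF past_measurable]) simp
  then show ?thesis unfolding position_def by (simp add: twin_rank_past)
qed

lemma integrable_position_diff_sq: "integrable M (\<lambda>\<omega>. (position m i \<omega> - position n i \<omega>) ^ 2)"
  by (rule integrable_const_bound[where B = 1]) (auto simp: position_diff_sq_le)

text \<open>
  The increments of a martingale are orthogonal, and the increment at time \<open>m\<close> is at most \<open>1 / (m + 2)\<close> in
  size; the right-hand side telescopes \<open>1 / (m + 1) - 1 / (m + 2)\<close>, which exceeds \<open>1 / (m + 2)\<^sup>2\<close>. The
  martingale starts only at time \<open>i\<close>, when vertex \<open>i\<close> appears.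
\<close>
lemma position_second_moment:
  assumes "i \<le> n" "n \<le> m"
  shows "expectation (\<lambda>\<omega>. (position m i \<omega> - position n i \<omega>) ^ 2)
    \<le> 1 / (real n + 1) - 1 / (real m + 1)"
  using assms(2)
proof (induction m rule: dec_induct)
  case base
  then show ?case by simp
next
  case (step m)
  define F where "F w a = ((real (twin_rank w m i) + of_bool (twin_rank w m a < twin_rank w m i)) / (real m + 2)
    - real (twin_rank w n i) / (real n + 1)) ^ 2" for w a
  have rank_m: "(real (twin_rank w m i) + of_bool c) / (real m + 2) \<le> 1" for w c
    using twin_rank_le[of w m i] by (auto simp: of_bool_def)
  have rank_n: "real (twin_rank w n i) / (real n + 1) \<le> 1" for w
    using twin_rank_le[of w n i] by auto
  have F_bound: "\<bar>F w a\<bar> \<le> 1" for w a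
  proof -
    have "0 \<le> (real (twin_rank w m i) + of_bool (twin_rank w m a < twin_rank w m i)) / (real m + 2)"
      "0 \<le> real (twin_rank w n i) / (real n + 1)" by auto
    then have "\<bar>(real (twin_rank w m i) + of_bool (twin_rank w m a < twin_rank w m i)) / (real m + 2)
        - real (twin_rank w n i) / (real n + 1)\<bar> \<le> 1"
      using rank_m[of w "twin_rank w m a < twin_rank w m i"] rank_n[of w] by linarith
    then show ?thesis unfolding F_def by (simp add: abs_square_le_1)
  qed
  have "expectation (\<lambda>\<omega>. (position (Suc m) i \<omega> - position n i \<omega>) ^ 2)
      = expectation (\<lambda>\<omega>. F (past m \<omega>) (V (Suc m) \<omega>))"
    using assms(1) step.hyps unfolding F_def position_def by (simp add: twin_rank_past add.commute)
  also have "\<dots> = expectation (\<lambda>\<omega>. (\<Sum>a\<le>m. F (past m \<omega>) a) / (real m + 1))"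
    using F_bound by (rule expectation_step)
  also have "\<dots> \<le> expectation (\<lambda>\<omega>. (position m i \<omega> - position n i \<omega>) ^ 2 + 1 / (real m + 2) ^ 2)"
  proof (rule integral_mono_AE)
    have "(\<lambda>\<omega>. (\<Sum>a\<le>m. F (past m \<omega>) a) / (real m + 1)) \<in> borel_measurable M"
      by (rule measurable_compose[OF past_measurable]) simp
    moreover have "\<bar>(\<Sum>a\<le>m. F w a) / (real m + 1)\<bar> \<le> 1" for w
    proof -
      have "\<bar>\<Sum>a\<le>m. F w a\<bar> \<le> (\<Sum>a\<le>m. 1)"
        using F_bound by (intro order_trans[OF sum_abs] sum_mono)
      then show ?thesis by (simp add: abs_divide)
    qed
    ultimately show "integrable M (\<lambda>\<omega>. (\<Sum>a\<le>m. F (past m \<omega>) a) / (real m + 1))"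
      by (intro integrable_const_bound[where B = 1]) auto
    show "AE \<omega> in M. (\<Sum>a\<le>m. F (past m \<omega>) a) / (real m + 1)
        \<le> (position m i \<omega> - position n i \<omega>) ^ 2 + 1 / (real m + 2) ^ 2"
      using AE_V_less
    proof eventually_elim
      case (elim \<omega>)
      have bij: "bij_betw (twin_rank (\<lambda>j. V j \<omega>) m) {..m} {..m}" using elim by (intro bij_betw_twin_rank) auto
      show ?case
        using urn_second_moment[OF bij twin_rank_le[of "\<lambda>j. V j \<omega>" m i], of "position n i \<omega>"] step.hyps
        by (simp add: F_def twin_rank_past position_def field_simps)
    qed
  qed (intro Bochner_Integration.integrable_add integrable_position_diff_sq integrable_const)
  also have "\<dots> = expectation (\<lambda>\<omega>. (position m i \<omega> - position n i \<omega>) ^ 2) + 1 / (real m + 2) ^ 2"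
    by (simp add: integrable_position_diff_sq prob_space)
  also have "1 / (real m + 2) ^ 2 \<le> 1 / (real m + 1) - 1 / (real (Suc m) + 1)"
  proof -
    have "1 / (real m + 2) ^ 2 \<le> 1 / ((real m + 1) * (real m + 2))"
      unfolding power2_eq_square by (intro frac_le mult_mono) auto
    also have "\<dots> = 1 / (real m + 1) - 1 / (real (Suc m) + 1)" by (simp add: field_simps)
    finally show ?thesis .
  qed
  finally show ?case using step.IH by simp
qed

lemma AE_position_convergent: "AE \<omega> in M. \<forall>i. convergent (\<lambda>n. position n i \<omega>)"
proof -
  have "AE \<omega> in M. convergent (\<lambda>n. position n i \<omega>)" for i
  proof -
    define k where "k = Suc i"
    define a where "a s = (s + k) ^ 3" for s
    define D where "D s \<omega> = real (s + k) ^ 2 * (position (a (Suc s)) i \<omega> - position (a s) i \<omega>) ^ 2" for s \<omega>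
    have D_meas [measurable]: "D s \<in> borel_measurable M" for s unfolding D_def by measurable
    have D_nonneg: "0 \<le> D s \<omega>" for s \<omega> by (simp add: D_def)
    have D_int: "integrable M (D s)" for s
      unfolding D_def by (intro integrable_mult_right integrable_position_diff_sq)
    have ED: "expectation (D s) \<le> 7 * inverse (real (s + k) ^ 2)" for s
    proof -
      define t where "t = real (s + k)"
      have t: "1 \<le> t" by (simp add: t_def k_def)
      have "i \<le> a s"
      proof -
        have "s + k \<le> a s" unfolding a_def by (rule self_le_power) (auto simp: k_def)
        then show ?thesis by (simp add: k_def)
      qed
      moreover have "a s \<le> a (Suc s)" by (simp add: a_def power_mono)
      ultimately have "expectation (\<lambda>\<omega>. (position (a (Suc s)) i \<omega> - position (a s) i \<omega>) ^ 2)
          \<le> 1 / (real (a s) + 1) - 1 / (real (a (Suc s)) + 1)"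
        by (rule position_second_moment)
      also have "\<dots> = 1 / (t ^ 3 + 1) - 1 / ((t + 1) ^ 3 + 1)" by (simp add: a_def t_def add_ac)
      also have "\<dots> \<le> 7 / t ^ 4"
      proof -
        have "1 / (t ^ 3 + 1) - 1 / ((t + 1) ^ 3 + 1) = ((t + 1) ^ 3 - t ^ 3) / ((t ^ 3 + 1) * ((t + 1) ^ 3 + 1))"
        proof -
          have "t ^ 3 + 1 > 0" "(t + 1) ^ 3 + 1 > 0" using t by (simp_all add: add_pos_pos)
          then show ?thesis by (simp add: diff_frac_eq)
        qed
        also have "\<dots> \<le> (7 * t ^ 2) / (t ^ 3 * t ^ 3)"
        proof (rule frac_le)
          have "t \<le> t ^ 2" "1 \<le> t ^ 2" using t self_le_power[of t 2] one_le_power[of t 2] by auto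
          then show "(t + 1) ^ 3 - t ^ 3 \<le> 7 * t ^ 2"
            by (simp add: power3_eq_cube power2_eq_square algebra_simps)
          show "t ^ 3 * t ^ 3 \<le> (t ^ 3 + 1) * ((t + 1) ^ 3 + 1)"
            using t by (intro mult_mono) (auto intro: order_trans[OF power_mono[of t "t + 1" 3]])
        qed (use t in auto)
        also have "\<dots> = 7 / t ^ 4" using t by (simp add: field_simps flip: power_add)
        finally show ?thesis .
      qed
      finally have "t ^ 2 * expectation (\<lambda>\<omega>. (position (a (Suc s)) i \<omega> - position (a s) i \<omega>) ^ 2)
          \<le> t ^ 2 * (7 / t ^ 4)" by (intro mult_left_mono) auto
      also have "t ^ 2 * (7 / t ^ 4) = 7 * inverse (t ^ 2)" using t by (simp add: field_simps flip: power_add)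
      finally show ?thesis by (simp add: D_def[abs_def] t_def)
    qed
    have "summable (\<lambda>s. 7 * inverse (real (s + k) ^ 2))"
      by (intro summable_mult summable_ignore_initial_segment inverse_power_summable) simp
    then have "summable (\<lambda>s. expectation (D s))"
    proof (rule summable_comparison_test'[where N = 0])
      fix s :: nat
      have "norm (expectation (D s)) = expectation (D s)" by (simp add: D_nonneg integral_nonneg_AE)
      then show "norm (expectation (D s)) \<le> 7 * inverse (real (s + k) ^ 2)" using ED[of s] by linarith
    qed
    then have fin: "(\<Sum>s. ennreal (expectation (D s))) \<noteq> \<infinity>"
      by (simp add: suminf_ennreal2 D_nonneg integral_nonneg_AE)
    have "(\<integral>\<^sup>+\<omega>. (\<Sum>s. ennreal (D s \<omega>)) \<partial>M) = (\<Sum>s. ennreal (expectation (D s)))"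
      by (subst nn_integral_suminf) (simp_all add: nn_integral_eq_integral D_int D_nonneg)
    then have "AE \<omega> in M. (\<Sum>s. ennreal (D s \<omega>)) \<noteq> \<infinity>"
      using fin by (intro nn_integral_noteq_infinite) auto
    then show ?thesis
    proof eventually_elim
      case (elim \<omega>)
      show ?case
      proof (rule slowly_varying_convergent[where k = k])
        show "\<bar>position (Suc n) i \<omega> - position n i \<omega>\<bar> \<le> 1 / (real n + 2)" if "k \<le> n" for n
          using twin_rank_increment[of i n "\<lambda>j. V j \<omega>"] that
          by (simp add: position_def k_def add.commute del: twin_rank.simps)
        have "summable (\<lambda>s. D s \<omega>)"
          using elim D_nonneg by (intro summable_suminf_not_top) (auto simp: infinity_ennreal_def)
        then show "summable (\<lambda>s. real (s + k) ^ 2 *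
            (position ((Suc s + k) ^ 3) i \<omega> - position ((s + k) ^ 3) i \<omega>) ^ 2)"
          by (simp add: D_def a_def)
      qed (simp add: k_def)
    qed
  qed
  then show ?thesis by (subst AE_all_countable) auto
qed

definition limit_position :: "nat \<Rightarrow> 'a \<Rightarrow> real" where
  "limit_position i \<omega> = lim (\<lambda>n. position n i \<omega>)"

lemma limit_position_measurable [measurable]: "limit_position i \<in> borel_measurable M"
  unfolding limit_position_def by measurable

lemma AE_position_tendsto: "AE \<omega> in M. \<forall>i. (\<lambda>n. position n i \<omega>) \<longlonglongrightarrow> limit_position i \<omega>"
  using AE_position_convergent
  by eventually_elim (simp add: limit_position_def convergent_LIMSEQ_iff)

lemma limit_position_second_moment:
  assumes "i \<le> n"
  shows "(\<integral>\<^sup>+\<omega>. ennreal ((limit_position i \<omega> - position n i \<omega>) ^ 2) \<partial>M) \<le> ennreal (1 / (real n + 1))"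
proof -
  have "(\<integral>\<^sup>+\<omega>. ennreal ((limit_position i \<omega> - position n i \<omega>) ^ 2) \<partial>M)
      = (\<integral>\<^sup>+\<omega>. liminf (\<lambda>m. ennreal ((position m i \<omega> - position n i \<omega>) ^ 2)) \<partial>M)"
  proof (rule nn_integral_cong_AE)
    show "AE \<omega> in M. ennreal ((limit_position i \<omega> - position n i \<omega>) ^ 2)
        = liminf (\<lambda>m. ennreal ((position m i \<omega> - position n i \<omega>) ^ 2))"
      using AE_position_tendsto
    proof eventually_elim
      case (elim \<omega>)
      then have "(\<lambda>m. ennreal ((position m i \<omega> - position n i \<omega>) ^ 2))
          \<longlonglongrightarrow> ennreal ((limit_position i \<omega> - position n i \<omega>) ^ 2)"
        by (intro tendsto_ennrealI tendsto_intros) auto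
      then show ?case by (rule lim_imp_Liminf[OF sequentially_bot, symmetric])
    qed
  qed
  also have "\<dots> \<le> liminf (\<lambda>m. \<integral>\<^sup>+\<omega>. ennreal ((position m i \<omega> - position n i \<omega>) ^ 2) \<partial>M)"
    by (rule nn_integral_liminf) measurable
  also have "\<dots> \<le> liminf (\<lambda>m. ennreal (1 / (real n + 1)))"
  proof (rule Liminf_mono)
    show "\<forall>\<^sub>F m in sequentially. (\<integral>\<^sup>+\<omega>. ennreal ((position m i \<omega> - position n i \<omega>) ^ 2) \<partial>M)
        \<le> ennreal (1 / (real n + 1))"
      using eventually_ge_at_top[of n]
    proof eventually_elim
      case (elim m)
      have "expectation (\<lambda>\<omega>. (position m i \<omega> - position n i \<omega>) ^ 2) \<le> 1 / (real n + 1)"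
        using position_second_moment[OF assms elim] by (rule order_trans) simp
      then show ?case by (simp add: nn_integral_eq_integral integrable_position_diff_sq ennreal_leI)
    qed
  qed
  also have "\<dots> = ennreal (1 / (real n + 1))" by (simp add: Liminf_const)
  finally show ?thesis .
qed

text \<open>
  By Fatou's lemma the total squared displacement \<open>S n\<close> has an almost surely finite lower limit, since its
  expectation is at most \<open>(n + 1) \<cdot> 1 / (n + 1)\<close>.
\<close>
lemma AE_limit_position_dense:
  "AE \<omega> in M. \<forall>a b. 0 \<le> a \<longrightarrow> a < b \<longrightarrow> b \<le> 1 \<longrightarrow>
    (\<exists>i. a < limit_position i \<omega> \<and> limit_position i \<omega> < b)"
proof -
  define S where "S n \<omega> = (\<Sum>i\<le>n. (limit_position i \<omega> - position n i \<omega>) ^ 2)" for n \<omega>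
  have S_meas [measurable]: "S n \<in> borel_measurable M" for n unfolding S_def by measurable
  have ES: "(\<integral>\<^sup>+\<omega>. ennreal (S n \<omega>) \<partial>M) \<le> 1" for n
  proof -
    have "(\<integral>\<^sup>+\<omega>. ennreal (S n \<omega>) \<partial>M)
        = (\<integral>\<^sup>+\<omega>. (\<Sum>i\<le>n. ennreal ((limit_position i \<omega> - position n i \<omega>) ^ 2)) \<partial>M)"
      unfolding S_def by (simp add: sum_ennreal)
    also have "\<dots> = (\<Sum>i\<le>n. \<integral>\<^sup>+\<omega>. ennreal ((limit_position i \<omega> - position n i \<omega>) ^ 2) \<partial>M)"
      by (rule nn_integral_sum) measurable
    also have "\<dots> \<le> (\<Sum>i\<le>n. ennreal (1 / (real n + 1)))"
      by (intro sum_mono limit_position_second_moment) simp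
    also have "\<dots> = ennreal (\<Sum>i\<le>n. 1 / (real n + 1))" by (rule sum_ennreal) simp
    also have "(\<Sum>i\<le>n. 1 / (real n + 1)) = 1" by simp
    finally show ?thesis by simp
  qed
  have "(\<integral>\<^sup>+\<omega>. liminf (\<lambda>n. ennreal (S n \<omega>)) \<partial>M) \<le> liminf (\<lambda>n. \<integral>\<^sup>+\<omega>. ennreal (S n \<omega>) \<partial>M)"
    by (rule nn_integral_liminf) measurable
  also have "\<dots> \<le> liminf (\<lambda>n. 1)" by (intro Liminf_mono always_eventually allI ES)
  finally have "(\<integral>\<^sup>+\<omega>. liminf (\<lambda>n. ennreal (S n \<omega>)) \<partial>M) \<noteq> \<infinity>"
    by (auto simp: Liminf_const top_unique)
  then have "AE \<omega> in M. liminf (\<lambda>n. ennreal (S n \<omega>)) \<noteq> \<infinity>"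
    by (intro nn_integral_noteq_infinite) measurable
  with AE_V_less show ?thesis
  proof eventually_elim
    case (elim \<omega>)
    then obtain K where K: "liminf (\<lambda>n. ennreal (S n \<omega>)) = ennreal K" "0 \<le> K"
      by (cases "liminf (\<lambda>n. ennreal (S n \<omega>))") auto
    have freq: "\<exists>\<^sub>F n in sequentially. S n \<omega> < K + 1"
    proof (rule ccontr)
      assume "\<not> (\<exists>\<^sub>F n in sequentially. S n \<omega> < K + 1)"
      then have "\<forall>\<^sub>F n in sequentially. ennreal (K + 1) \<le> ennreal (S n \<omega>)"
        by (simp add: not_frequently not_less) (auto elim!: eventually_mono intro: ennreal_leI)
      then have "ennreal (K + 1) \<le> liminf (\<lambda>n. ennreal (S n \<omega>))" by (rule Liminf_bounded)
      then show False using K by (simp add: ennreal_le_iff)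
    qed
    show ?case
    proof (intro allI impI)
      fix a b :: real assume "0 \<le> a" "a < b" "b \<le> 1"
      then show "\<exists>i. a < limit_position i \<omega> \<and> limit_position i \<omega> < b"
        using freq elim(1) unfolding S_def position_def
        by (intro dense_of_bounded_displacement[where \<sigma> = "twin_rank (\<lambda>j. V j \<omega>)"] bij_betw_twin_rank) auto
    qed
  qed
qed

end

section \<open>Convergence to the recursive cographon\<close>

theorem theorem1p11:
  fixes M :: "'a measure" and p :: real and G :: "nat \<Rightarrow> 'a \<Rightarrow> nat pair_pre_digraph"
  assumes "prob_space M"
    and "0 < p" and "p < 1"
    and "recursive_cographs M p G"
  shows "\<exists>W. W \<in> M \<rightarrow>\<^sub>M graphon_borel
           \<and> (AE \<omega> in M. converges_to_graphon (\<lambda>n. G n \<omega>) (W \<omega>))"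
proof -
  interpret prob_space M by fact
  obtain V B where indep: "indep_vars (\<lambda>_. count_space UNIV) (\<lambda>n \<omega>. (V n \<omega>, B n \<omega>)) {1..}"
    and law: "\<And>n. n \<ge> 1 \<Longrightarrow> distr M (count_space UNIV) (\<lambda>\<omega>. (V n \<omega>, B n \<omega>))
                = measure_pmf (pair_pmf (pmf_of_set {..<n}) (bernoulli_pmf (1 - p)))"
    and init: "\<And>\<omega>. \<omega> \<in> space M \<Longrightarrow> G 1 \<omega> = \<lparr> pverts = {0}, parcs = {} \<rparr>"
    and step: "\<And>n \<omega>. n \<ge> 1 \<Longrightarrow> \<omega> \<in> space M \<Longrightarrow>
                G (n + 1) \<omega> = add_twin (V n \<omega>) n (B n \<omega>) (G n \<omega>)"
    using assms(4) unfolding recursive_cographs_def by blast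
  have pair [measurable]: "(\<lambda>\<omega>. (V n \<omega>, B n \<omega>)) \<in> M \<rightarrow>\<^sub>M count_space UNIV" if "n \<ge> 1" for n
    using indep that by (auto simp: indep_vars_def)
  interpret uniform_parents M V
  proof
    have "indep_vars (\<lambda>_. count_space UNIV) (\<lambda>n \<omega>. fst (V n \<omega>, B n \<omega>)) {1..}"
      using indep by (rule indep_vars_compose2) simp
    then show "indep_vars (\<lambda>_. count_space UNIV) V {1..}" by simp
    fix n :: nat assume n: "1 \<le> n"
    have "distr M (count_space UNIV) (V n) =
        distr (distr M (count_space UNIV) (\<lambda>\<omega>. (V n \<omega>, B n \<omega>))) (count_space UNIV) fst"
      using pair[OF n] by (subst distr_distr) (auto simp: comp_def)
    also have "\<dots> = measure_pmf (map_pmf fst (pair_pmf (pmf_of_set {..<n}) (bernoulli_pmf (1 - p))))"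
      unfolding law[OF n] map_pmf_rep_eq ..
    finally show "distr M (count_space UNIV) (V n) = measure_pmf (pmf_of_set {..<n})"
      by (simp add: map_fst_pair_pmf)
  qed
  have G_meas: "G (Suc n) \<in> M \<rightarrow>\<^sub>M count_space UNIV" for n
  proof (induction n)
    case 0
    show ?case using init by (subst measurable_cong[where g = "\<lambda>_. \<lparr> pverts = {0}, parcs = {} \<rparr>"]) auto
  next
    case (Suc n)
    have "(\<lambda>\<omega>. add_twin (fst (V (Suc n) \<omega>, B (Suc n) \<omega>)) (Suc n) (snd (V (Suc n) \<omega>, B (Suc n) \<omega>)) (G (Suc n) \<omega>))
        \<in> M \<rightarrow>\<^sub>M count_space UNIV"
      by (rule measurable_compose_countable[where f = "\<lambda>c \<omega>. add_twin (fst c) (Suc n) (snd c) (G (Suc n) \<omega>)"])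
        (auto intro: measurable_compose[OF Suc] pair)
    then show ?case
      using step[of "Suc n"] by (subst measurable_cong) auto
  qed
  define W where "W \<omega> = cographon (\<lambda>i. limit_position i \<omega>) (\<lambda>n. B n \<omega>)" for \<omega>
  have conv: "AE \<omega> in M. (\<lambda>n. cut_distance (step_graphon (G (Suc n) \<omega>)) (W \<omega>)) \<longlonglongrightarrow> 0"
    using AE_V_less AE_position_tendsto AE_limit_position_dense AE_space
  proof eventually_elim
    case (elim \<omega>)
    define v where "v = (\<lambda>j. V j \<omega>)"
    define b where "b = (\<lambda>j. B j \<omega>)"
    define u where "u n i = position n i \<omega>" for n i
    have v: "v n < n" if "1 \<le> n" for n using elim(1) that by (simp add: v_def)
    have kW: "W \<omega> \<in> kernels" using graphons_subset_kernels cographon_graphon by (auto simp: W_def)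
    have upper: "cut_distance (step_graphon (G (Suc n) \<omega>)) (W \<omega>)
        \<le> (\<integral>z. \<bar>cographon (u n) b z - W \<omega> z\<bar> \<partial>unit_square)" for n
    proof -
      have graph: "pverts (G (Suc n) \<omega>) = {..n}"
        "\<And>i j. i \<le> n \<Longrightarrow> j \<le> n \<Longrightarrow> (i, j) \<in> parcs (G (Suc n) \<omega>) \<longleftrightarrow>
          first_label (twin_rank v n) b (twin_rank v n i) (twin_rank v n j)"
        using grown_graph[of "\<lambda>n. G n \<omega>" v b n] init step v elim(4) by (auto simp: v_def b_def)
      have "bij_betw (twin_rank v n) {..<Suc n} {..<Suc n}"
        using bij_betw_twin_rank[of n v] v by (simp add: lessThan_Suc_atMost)
      then have "cut_distance (step_graphon (G (Suc n) \<omega>)) (W \<omega>)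
          \<le> (\<integral>z. \<bar>cographon (\<lambda>m. real (twin_rank v n m) / Suc n) b z - W \<omega> z\<bar> \<partial>unit_square)"
        by (intro cut_distance_step_graphon_le kW) (auto simp: graph)
      then show ?thesis by (simp add: u_def[abs_def] position_def v_def add.commute)
    qed
    have L1: "(\<lambda>n. \<integral>z. \<bar>cographon (u n) b z - W \<omega> z\<bar> \<partial>unit_square) \<longlonglongrightarrow> 0"
      unfolding W_def b_def using elim(2,3) by (intro tendsto_cographon_L1) (auto simp: u_def)
    show ?case
      by (rule tendsto_sandwich[OF _ _ tendsto_const L1])
        (intro always_eventually allI upper cut_distance_nonneg step_graphon_kernel kW)+
  qed
  then obtain N where N: "N \<in> null_sets M"
    "\<And>\<omega>. \<omega> \<in> space M - N \<Longrightarrow> (\<lambda>n. cut_distance (step_graphon (G (Suc n) \<omega>)) (W \<omega>)) \<longlonglongrightarrow> 0"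
    by (rule AE_E3) blast
  have zero: "(\<lambda>_. 0) \<in> graphons" by (auto simp: graphons_def)
  \<comment> \<open>Redefining the limit on a null set makes the convergence, and hence the measurability, hold everywhere.\<close>
  define W' where "W' \<omega> = (if \<omega> \<in> N then (\<lambda>_. 0) else W \<omega>)" for \<omega>
  define S where "S n \<omega> = (if \<omega> \<in> N then (\<lambda>_. 0) else step_graphon (G (Suc n) \<omega>))" for n \<omega>
  have "W' \<in> M \<rightarrow>\<^sub>M graphon_borel"
  proof (rule measurable_graphon_limit[where S = S])
    fix n X
    have "{\<omega> \<in> space M. S n \<omega> \<in> X} =
        (if (\<lambda>_. 0) \<in> X then N else {}) \<union> (G (Suc n) -` {H. step_graphon H \<in> X} \<inter> space M - N)"
      using sets.sets_into_space[OF null_setsD2[OF N(1)]] by (auto simp: S_def)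
    also have "\<dots> \<in> sets M"
      using N(1) measurable_sets[OF G_meas, of "{H. step_graphon H \<in> X}" n] by auto
    finally show "{\<omega> \<in> space M. S n \<omega> \<in> X} \<in> sets M" .
  next
    fix \<omega> assume \<omega>: "\<omega> \<in> space M"
    show "S n \<omega> \<in> kernels" for n
      using zero graphons_subset_kernels step_graphon_kernel by (auto simp: S_def)
    show "W' \<omega> \<in> graphons" by (simp add: W'_def zero W_def cographon_graphon)
    show "(\<lambda>n. cut_distance (S n \<omega>) (W' \<omega>)) \<longlonglongrightarrow> 0"
    proof (cases "\<omega> \<in> N")
      case True
      have "(\<lambda>_. 0) \<in> kernels" using zero graphons_subset_kernels by blast
      then show ?thesis using True by (simp add: S_def W'_def cut_distance_refl)
    qed (use N(2) \<omega> in \<open>simp add: S_def W'_def\<close>)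
  qed
  moreover have "AE \<omega> in M. converges_to_graphon (\<lambda>n. G n \<omega>) (W' \<omega>)"
    using AE_not_in[OF N(1)] AE_space
  proof eventually_elim
    case (elim \<omega>)
    then have "(\<lambda>n. cut_distance (step_graphon (G (Suc n) \<omega>)) (W' \<omega>)) \<longlonglongrightarrow> 0"
      using N(2) by (simp add: W'_def)
    then show ?case
      unfolding converges_to_graphon_def by (rule LIMSEQ_imp_Suc)
  qed
  ultimately show ?thesis by blast
qed


end
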